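(* Let $n\in\mathbb{N}$ be fixed, let $B\cong\bigoplus_{a=1}^d M_n(\mathbb{C})$, let $\psi$ be a faithful $\delta$-form on $B$, let $D$ be the dephasing graph on $(B,\psi)$, and let $s:B\to L\mathcal{O}(B,\psi,D)$ be the universal local quantum Cuntz--Krieger $(B,\psi,D)$-family. For $1\le a\le d$ and $1\le i,j\le n$ set $$t^{(a)}_{ij}:=\delta\,\psi(e^{(a)}_{ii})^{1/2}\,s(f^{(a)}_{ij}),\qquad V_i:=\sum_{a=1}^d\sum_{j=1}^n t^{(a)}_{ij}\quad(1\le i\le n).$$ Then $\{V_i:1\le i\le n\}$ consists of Cuntz isometries, i.e. $V_i^*V_i=1$ for each $i$ and $\sum_{i=1}^nV_iV_i^*=1$, and they generate a unital embedding of the Cuntz algebra $\mathcal{O}_n$ inside $L\mathcal{O}(B,\psi,D)$; that is, there is an injective unital $*$-homomorphism $\mathcal{O}_n\to L\mathcal{O}(B,\psi,D)$ sending the $i$-th canonical generator of $\mathcal{O}_n$ to $V_i$ for each $i$.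
   Context: Let $B=\bigoplus_{a=1}^d M_{n_a}(\mathbb{C})$ be a finite-dimensional $C^*$-algebra with a state $\psi$, and write $\psi(x)=\sum_a \mathrm{Tr}_a(\rho^{(a)}x^{(a)})$ with density matrix $\rho=\bigoplus_a\rho^{(a)}$ ($\mathrm{Tr}_a$ is the non-normalized trace on $M_{n_a}$). For $\delta>0$, $\psi$ is a $\delta$-form if $\rho$ is invertible and $\mathrm{Tr}_a((\rho^{(a)})^{-1})=\delta^2$ for every $a$. Matrix units $e^{(a)}_{ij}$ of $B$ are chosen so that each $\rho^{(a)}$ is diagonal, and the adapted matrix units are $f^{(a)}_{ij}:=\psi(e^{(a)}_{ii})^{-1/2}\psi(e^{(a)}_{jj})^{-1/2}e^{(a)}_{ij}$. Let $m:B\otimes B\to B$, $m(x\otimes y)=xy$, and let $m^*:B\to B\otimes B$ be its Hilbert space adjoint with respect to the inner products $\langle x,y\rangle=\psi(x^*y)$ on $B$ and the one induced by $\psi\otimes\psi$ on $B\otimes B$. (Then $m^*(f^{(a)}_{ij})=\sum_k f^{(a)}_{ik}\otimes f^{(a)}_{kj}$.) The dephasing graph is the linear map $D:B\to B$ determined by $D(f^{(a)}_{ij})=\delta_{i=j}\,\psi(e^{(a)}_{ii})\,\delta^2 f^{(a)}_{ii}$, where $\delta_{i=j}$ is the Kronecker delta; it is completely positive and satisfies $m(D\otimes D)m^*=\delta^2D$. For a unital $C^*$-algebra $\mathcal{C}$ let $\mu:\mathcal{C}\odot\mathcal{C}\to\mathcal{C}$, $\mu(x\otimes y)=xy$. For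 a linear map $S:B\to\mathcal{C}$, let $S^*:B\to\mathcal{C}$ be the linear map $S^*(x):=S(x^* )^*$. For a linear map $A:B\to B$, $S$ is a local quantum Cuntz--Krieger $(B,\psi,A)$-family if (LQCK1) $\mu(\mu\otimes\mathrm{id})(S\otimes S^*\otimes S)(m^*\otimes\mathrm{id})=\delta^{-2}S\,m$ as maps $B\otimes B\to\mathcal{C}$; (LQCK2) $\mu(S^*\otimes S)=\delta^{-2}\mu(S\otimes S^* )m^*A\,m$ as maps $B\otimes B\to\mathcal{C}$; (LQCK3) $\mu(S\otimes S^* )m^*(1_B)=\delta^{-2}1_{\mathcal{C}}$. Such a family $s$ is universal if for every local quantum Cuntz--Krieger $(B,\psi,A)$-family $S$ (into any unital $C^*$-algebra) there is a surjective $*$-homomorphism $\rho:C^*(s(B))\to C^*(S(B))$ with $\rho\circ s=S$. The local quantum Cuntz--Krieger algebra $L\mathcal{O}(B,\psi,A)$ is the $C^*$-algebra generated by the range of the universal family. $\mathcal{O}_n$ is the universal unital $C^*$-algebra generated by isometries $v_1,\dots,v_n$ with $\sum_i v_iv_i^*=1$. *)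

theory Defs
  imports "HOL-Analysis.Analysis" "HOL-Algebra.Ring"
begin

section \<open>Unital C*-algebras\<close>

record 'u cstar = "'u ring" +
  scale :: "complex \<Rightarrow> 'u \<Rightarrow> 'u"
  star :: "'u \<Rightarrow> 'u"
  cnorm :: "'u \<Rightarrow> real"

text \<open>The zero algebra is admitted.\<close>

locale unital_cstar_algebra = ring A for A :: "('u, 'r) cstar_scheme" (structure) +
  assumes scale_closed: "x \<in> carrier A \<Longrightarrow> scale A c x \<in> carrier A"
    and scale_add_right:
      "\<lbrakk>x \<in> carrier A; y \<in> carrier A\<rbrakk> \<Longrightarrow> scale A c (x \<oplus> y) = scale A c x \<oplus> scale A c y"
    and scale_add_left: "x \<in> carrier A \<Longrightarrow> scale A (c + d) x = scale A c x \<oplus> scale A d x"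
    and scale_scale: "x \<in> carrier A \<Longrightarrow> scale A c (scale A d x) = scale A (c * d) x"
    and scale_one: "x \<in> carrier A \<Longrightarrow> scale A 1 x = x"
    and scale_mult_left:
      "\<lbrakk>x \<in> carrier A; y \<in> carrier A\<rbrakk> \<Longrightarrow> scale A c x \<otimes> y = scale A c (x \<otimes> y)"
    and scale_mult_right:
      "\<lbrakk>x \<in> carrier A; y \<in> carrier A\<rbrakk> \<Longrightarrow> x \<otimes> scale A c y = scale A c (x \<otimes> y)"
    and star_closed: "x \<in> carrier A \<Longrightarrow> star A x \<in> carrier A"
    and star_star: "x \<in> carrier A \<Longrightarrow> star A (star A x) = x"
    and star_add: "\<lbrakk>x \<in> carrier A; y \<in> carrier A\<rbrakk> \<Longrightarrow> star A (x \<oplus> y) = star A x \<oplus> star A y"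
    and star_scale: "x \<in> carrier A \<Longrightarrow> star A (scale A c x) = scale A (cnj c) (star A x)"
    and star_mult: "\<lbrakk>x \<in> carrier A; y \<in> carrier A\<rbrakk> \<Longrightarrow> star A (x \<otimes> y) = star A y \<otimes> star A x"
    and cnorm_nonneg: "x \<in> carrier A \<Longrightarrow> 0 \<le> cnorm A x"
    and cnorm_eq_zero: "x \<in> carrier A \<Longrightarrow> cnorm A x = 0 \<longleftrightarrow> x = \<zero>"
    and cnorm_triangle:
      "\<lbrakk>x \<in> carrier A; y \<in> carrier A\<rbrakk> \<Longrightarrow> cnorm A (x \<oplus> y) \<le> cnorm A x + cnorm A y"
    and cnorm_scale: "x \<in> carrier A \<Longrightarrow> cnorm A (scale A c x) = cmod c * cnorm A x"
    and cnorm_mult: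
      "\<lbrakk>x \<in> carrier A; y \<in> carrier A\<rbrakk> \<Longrightarrow> cnorm A (x \<otimes> y) \<le> cnorm A x * cnorm A y"
    and cstar_identity: "x \<in> carrier A \<Longrightarrow> cnorm A (star A x \<otimes> x) = (cnorm A x)\<^sup>2"
    and cnorm_complete:
      "\<lbrakk>\<And>k. X k \<in> carrier A; \<And>\<epsilon>. \<epsilon> > 0 \<Longrightarrow> \<exists>N. \<forall>k\<ge>N. \<forall>l\<ge>N. cnorm A (X k \<ominus> X l) < \<epsilon>\<rbrakk>
        \<Longrightarrow> \<exists>x\<in>carrier A. (\<lambda>k. cnorm A (X k \<ominus> x)) \<longlonglongrightarrow> 0"

definition cstar_subalgebra :: "('u, 'r) cstar_scheme \<Rightarrow> 'u set \<Rightarrow> bool" where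
  "cstar_subalgebra A H \<longleftrightarrow>
     H \<subseteq> carrier A \<and> \<zero>\<^bsub>A\<^esub> \<in> H \<and>
     (\<forall>x\<in>H. \<forall>y\<in>H. x \<oplus>\<^bsub>A\<^esub> y \<in> H \<and> x \<otimes>\<^bsub>A\<^esub> y \<in> H) \<and>
     (\<forall>x\<in>H. star A x \<in> H \<and> (\<forall>c. scale A c x \<in> H)) \<and>
     (\<forall>X x. (\<forall>k. X k \<in> H) \<and> x \<in> carrier A \<and> (\<lambda>k. cnorm A (X k \<ominus>\<^bsub>A\<^esub> x)) \<longlonglongrightarrow> 0 \<longrightarrow> x \<in> H)"

text \<open>
  \<open>cstar_generated A X\<close> is C*(X), with the structure inherited from \<open>A\<close>. The generated subalgebra
  is not required to contain the unit of \<open>A\<close>; for the families below it does.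
\<close>

definition cstar_generated :: "('u, 'r) cstar_scheme \<Rightarrow> 'u set \<Rightarrow> ('u, 'r) cstar_scheme" where
  "cstar_generated A X = A\<lparr>carrier := \<Inter>{H. cstar_subalgebra A H \<and> X \<subseteq> H}\<rparr>"

definition star_hom :: "('u, 'r) cstar_scheme \<Rightarrow> ('v, 's) cstar_scheme \<Rightarrow> ('u \<Rightarrow> 'v) \<Rightarrow> bool" where
  "star_hom A A' h \<longleftrightarrow>
     (\<forall>x\<in>carrier A. h x \<in> carrier A') \<and>
     (\<forall>x\<in>carrier A. \<forall>y\<in>carrier A.
        h (x \<oplus>\<^bsub>A\<^esub> y) = h x \<oplus>\<^bsub>A'\<^esub> h y \<and> h (x \<otimes>\<^bsub>A\<^esub> y) = h x \<otimes>\<^bsub>A'\<^esub> h y) \<and>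
     (\<forall>x\<in>carrier A. h (star A x) = star A' (h x) \<and> (\<forall>c. h (scale A c x) = scale A' c (h x)))"

definition unital_star_hom ::
  "('u, 'r) cstar_scheme \<Rightarrow> ('v, 's) cstar_scheme \<Rightarrow> ('u \<Rightarrow> 'v) \<Rightarrow> bool" where
  "unital_star_hom A A' h \<longleftrightarrow> star_hom A A' h \<and> h \<one>\<^bsub>A\<^esub> = \<one>\<^bsub>A'\<^esub>"

section \<open>The algebra B as a direct sum of full matrix algebras, and its tensor powers\<close>

text \<open>
  \<open>('d, 'n) blocks\<close> is the direct sum of CARD('d) copies of the n x n matrices, n = CARD('n);
  \<open>x $ a\<close> is the a-th summand. The tensor product of \<open>('d, 'n) blocks\<close> and \<open>('e, 'm) blocks\<close> is
  realised as \<open>('d \<times> 'e, 'n \<times> 'm) blocks\<close>, elementary tensors being blockwise Kronecker products.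
\<close>

type_synonym ('d, 'n) blocks = "((complex^'n)^'n)^'d"

definition bscale :: "complex \<Rightarrow> ('d::finite, 'n::finite) blocks \<Rightarrow> ('d, 'n) blocks" where
  "bscale c x = (\<chi> a i j. c * x $ a $ i $ j)"

definition bmult :: "('d::finite, 'n::finite) blocks \<Rightarrow> ('d, 'n) blocks \<Rightarrow> ('d, 'n) blocks" where
  "bmult x y = (\<chi> a. x $ a ** y $ a)"

definition bone :: "('d::finite, 'n::finite) blocks" where
  "bone = (\<chi> a. mat 1)"

definition bstar :: "('d::finite, 'n::finite) blocks \<Rightarrow> ('d, 'n) blocks" where
  "bstar x = (\<chi> a i j. cnj (x $ a $ j $ i))"

definition std_unit :: "'d::finite \<Rightarrow> 'n::finite \<Rightarrow> 'n \<Rightarrow> ('d, 'n) blocks" where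
  "std_unit a i j = (\<chi> b k l. if b = a \<and> k = i \<and> l = j then 1 else 0)"

abbreviation blinear ::
  "(('d::finite, 'n::finite) blocks \<Rightarrow> ('e::finite, 'm::finite) blocks) \<Rightarrow> bool" where
  "blinear \<equiv> Vector_Spaces.linear bscale bscale"

definition tensor ::
  "('d::finite, 'n::finite) blocks \<Rightarrow> ('e::finite, 'm::finite) blocks \<Rightarrow> ('d \<times> 'e, 'n \<times> 'm) blocks"
  where "tensor x y = (\<chi> p q r. x $ fst p $ fst q $ fst r * y $ snd p $ snd q $ snd r)"

text \<open>
  A linear map on a tensor product is given by its values on the tensors of standard matrix units.
  The lemmas on elementary tensors below show that these are the intended maps.
\<close>

definition tensor_functional ::
  "(('d::finite, 'n::finite) blocks \<Rightarrow> complex) \<Rightarrow> (('e::finite, 'm::finite) blocks \<Rightarrow> complex)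
    \<Rightarrow> ('d \<times> 'e, 'n \<times> 'm) blocks \<Rightarrow> complex" where
  "tensor_functional \<phi> \<omega> z =
     (\<Sum>(a, i, j)\<in>UNIV. \<Sum>(b, k, l)\<in>UNIV.
        z $ (a, b) $ (i, k) $ (j, l) * (\<phi> (std_unit a i j) * \<omega> (std_unit b k l)))"

definition tensor_map ::
  "(('d::finite, 'n::finite) blocks \<Rightarrow> ('d2::finite, 'n2::finite) blocks)
    \<Rightarrow> (('e::finite, 'm::finite) blocks \<Rightarrow> ('e2::finite, 'm2::finite) blocks)
    \<Rightarrow> ('d \<times> 'e, 'n \<times> 'm) blocks \<Rightarrow> ('d2 \<times> 'e2, 'n2 \<times> 'm2) blocks" where
  "tensor_map F G z =
     (\<Sum>(a, i, j)\<in>UNIV. \<Sum>(b, k, l)\<in>UNIV.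
        bscale (z $ (a, b) $ (i, k) $ (j, l)) (tensor (F (std_unit a i j)) (G (std_unit b k l))))"

definition mult_map :: "('d::finite \<times> 'd, 'n::finite \<times> 'n) blocks \<Rightarrow> ('d, 'n) blocks" where
  "mult_map z =
     (\<Sum>(a, i, j)\<in>UNIV. \<Sum>(b, k, l)\<in>UNIV.
        bscale (z $ (a, b) $ (i, k) $ (j, l)) (bmult (std_unit a i j) (std_unit b k l)))"

text \<open>
  \<open>mu_tensor C S T\<close> is the composition of the tensor product of \<open>S\<close> and \<open>T\<close> with the multiplication
  map of \<open>C\<close>, i.e. the linear map that sends the elementary tensor of \<open>x\<close> and \<open>y\<close> to \<open>S x \<otimes> T y\<close>.
\<close>

definition mu_tensor ::
  "('u, 'r) cstar_scheme \<Rightarrow> (('d::finite, 'n::finite) blocks \<Rightarrow> 'u)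
    \<Rightarrow> (('e::finite, 'm::finite) blocks \<Rightarrow> 'u) \<Rightarrow> ('d \<times> 'e, 'n \<times> 'm) blocks \<Rightarrow> 'u" where
  "mu_tensor C S T z =
     finsum C (\<lambda>(a, i, j). finsum C (\<lambda>(b, k, l).
        scale C (z $ (a, b) $ (i, k) $ (j, l)) (S (std_unit a i j) \<otimes>\<^bsub>C\<^esub> T (std_unit b k l)))
        UNIV) UNIV"

section \<open>States, delta-forms and adapted matrix units\<close>

definition state :: "(('d::finite, 'n::finite) blocks \<Rightarrow> complex) \<Rightarrow> bool" where
  "state \<psi> \<longleftrightarrow> Vector_Spaces.linear bscale (*) \<psi> \<and>
     (\<forall>x. \<psi> (bmult (bstar x) x) \<in> \<real>\<^sub>\<ge>\<^sub>0) \<and> \<psi> bone = 1"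

definition faithful :: "(('d::finite, 'n::finite) blocks \<Rightarrow> complex) \<Rightarrow> bool" where
  "faithful \<psi> \<longleftrightarrow> (\<forall>x. \<psi> (bmult (bstar x) x) = 0 \<longrightarrow> x = 0)"

definition is_density ::
  "(('d::finite, 'n::finite) blocks \<Rightarrow> complex) \<Rightarrow> ('d, 'n) blocks \<Rightarrow> bool" where
  "is_density \<psi> \<rho> \<longleftrightarrow> (\<forall>x. \<psi> x = (\<Sum>a\<in>UNIV. trace (\<rho> $ a ** x $ a)))"

definition delta_form ::
  "real \<Rightarrow> (('d::finite, 'n::finite) blocks \<Rightarrow> complex) \<Rightarrow> bool" where
  "delta_form \<delta> \<psi> \<longleftrightarrow> 0 < \<delta> \<and>
     (\<exists>\<rho>. is_density \<psi> \<rho> \<and>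
        (\<forall>a. invertible (\<rho> $ a) \<and> trace (matrix_inv (\<rho> $ a)) = of_real (\<delta>\<^sup>2)))"

text \<open>
  A system of matrix units of B, not necessarily the standard one; \<open>e a i j\<close> lies in the a-th
  summand, so that for each \<open>a\<close> it is a system of matrix units of that summand.
\<close>

definition matrix_units ::
  "('d::finite \<Rightarrow> 'n::finite \<Rightarrow> 'n \<Rightarrow> ('d, 'n) blocks) \<Rightarrow> bool" where
  "matrix_units e \<longleftrightarrow>
     (\<forall>a b i j. b \<noteq> a \<longrightarrow> e a i j $ b = 0) \<and>
     (\<forall>a i j k l. bmult (e a i j) (e a k l) = (if j = k then e a i l else 0)) \<and>
     (\<forall>a i j. bstar (e a i j) = e a j i) \<and>
     (\<Sum>a\<in>UNIV. \<Sum>i\<in>UNIV. e a i i) = bone"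

definition diagonalises ::
  "('d::finite \<Rightarrow> 'n::finite \<Rightarrow> 'n \<Rightarrow> ('d, 'n) blocks) \<Rightarrow> (('d, 'n) blocks \<Rightarrow> complex) \<Rightarrow> bool"
  where
  "diagonalises e \<psi> \<longleftrightarrow>
     (\<exists>\<rho> c. is_density \<psi> \<rho> \<and> \<rho> = (\<Sum>a\<in>UNIV. \<Sum>i\<in>UNIV. bscale (c a i) (e a i i)))"

text \<open>For a faithful state the values \<open>\<psi> (e a i i)\<close> are positive reals; \<open>Re\<close> only changes the type.\<close>

definition adapted_unit ::
  "(('d::finite, 'n::finite) blocks \<Rightarrow> complex) \<Rightarrow> ('d \<Rightarrow> 'n \<Rightarrow> 'n \<Rightarrow> ('d, 'n) blocks)
    \<Rightarrow> 'd \<Rightarrow> 'n \<Rightarrow> 'n \<Rightarrow> ('d, 'n) blocks" where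
  "adapted_unit \<psi> e a i j =
     bscale (of_real (Re (\<psi> (e a i i)) powr (- 1/2) * Re (\<psi> (e a j j)) powr (- 1/2))) (e a i j)"

definition gns_inner ::
  "(('d::finite, 'n::finite) blocks \<Rightarrow> complex) \<Rightarrow> ('d, 'n) blocks \<Rightarrow> ('d, 'n) blocks \<Rightarrow> complex"
  where "gns_inner \<psi> x y = \<psi> (bmult (bstar x) y)"

definition mult_adjoint ::
  "(('d::finite, 'n::finite) blocks \<Rightarrow> complex) \<Rightarrow> ('d, 'n) blocks \<Rightarrow> ('d \<times> 'd, 'n \<times> 'n) blocks"
  where
  "mult_adjoint \<psi> = (THE M. blinear M \<and>
     (\<forall>x z. gns_inner (tensor_functional \<psi> \<psi>) (M x) z = gns_inner \<psi> x (mult_map z)))"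

definition dephasing_graph ::
  "real \<Rightarrow> (('d::finite, 'n::finite) blocks \<Rightarrow> complex) \<Rightarrow> ('d \<Rightarrow> 'n \<Rightarrow> 'n \<Rightarrow> ('d, 'n) blocks)
    \<Rightarrow> (('d, 'n) blocks \<Rightarrow> ('d, 'n) blocks) \<Rightarrow> bool" where
  "dephasing_graph \<delta> \<psi> e D \<longleftrightarrow> blinear D \<and>
     (\<forall>a i j. D (adapted_unit \<psi> e a i j) =
        (if i = j then bscale (\<psi> (e a i i) * of_real (\<delta>\<^sup>2)) (adapted_unit \<psi> e a i i) else 0))"

section \<open>Local quantum Cuntz--Krieger families\<close>

definition linear_into ::
  "('u, 'r) cstar_scheme \<Rightarrow> (('d::finite, 'n::finite) blocks \<Rightarrow> 'u) \<Rightarrow> bool" where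
  "linear_into C S \<longleftrightarrow> (\<forall>x. S x \<in> carrier C) \<and>
     (\<forall>x y. S (x + y) = S x \<oplus>\<^bsub>C\<^esub> S y) \<and> (\<forall>c x. S (bscale c x) = scale C c (S x))"

definition map_star ::
  "('u, 'r) cstar_scheme \<Rightarrow> (('d::finite, 'n::finite) blocks \<Rightarrow> 'u) \<Rightarrow> ('d, 'n) blocks \<Rightarrow> 'u" where
  "map_star C S x = star C (S (bstar x))"

definition lqck_family ::
  "real \<Rightarrow> (('d::finite, 'n::finite) blocks \<Rightarrow> complex) \<Rightarrow> (('d, 'n) blocks \<Rightarrow> ('d, 'n) blocks)
    \<Rightarrow> ('u, 'r) cstar_scheme \<Rightarrow> (('d, 'n) blocks \<Rightarrow> 'u) \<Rightarrow> bool" where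
  "lqck_family \<delta> \<psi> A C S \<longleftrightarrow>
     unital_cstar_algebra C \<and> linear_into C S \<and>
     (\<forall>z. mu_tensor C (mu_tensor C S (map_star C S)) S (tensor_map (mult_adjoint \<psi>) id z)
          = scale C (of_real (inverse (\<delta>\<^sup>2))) (S (mult_map z))) \<and>
     (\<forall>z. mu_tensor C (map_star C S) S z
          = scale C (of_real (inverse (\<delta>\<^sup>2)))
              (mu_tensor C S (map_star C S) (mult_adjoint \<psi> (A (mult_map z))))) \<and>
     mu_tensor C S (map_star C S) (mult_adjoint \<psi> bone)
       = scale C (of_real (inverse (\<delta>\<^sup>2))) \<one>\<^bsub>C\<^esub>"

text \<open>
  Universality, here and for Cuntz algebras, is tested against all unital C*-algebras whose carrier
  is a subset of the type \<open>'u\<close>. Only the separable C*-algebra generated by the range of the family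
  is involved, and such an algebra has an isomorphic copy on every type with at least continuum
  many elements; for these \<open>'u\<close> this is universality among all unital C*-algebras. On a smaller
  type it is a weaker condition.
\<close>

definition universal_lqck_family ::
  "real \<Rightarrow> (('d::finite, 'n::finite) blocks \<Rightarrow> complex) \<Rightarrow> (('d, 'n) blocks \<Rightarrow> ('d, 'n) blocks)
    \<Rightarrow> 'u cstar \<Rightarrow> (('d, 'n) blocks \<Rightarrow> 'u) \<Rightarrow> bool" where
  "universal_lqck_family \<delta> \<psi> A C s \<longleftrightarrow> lqck_family \<delta> \<psi> A C s \<and>
     (\<forall>(C' :: 'u cstar) S. lqck_family \<delta> \<psi> A C' S \<longrightarrow>
        (\<exists>h. star_hom (cstar_generated C (range s)) (cstar_generated C' (range S)) h \<and>
             h ` carrier (cstar_generated C (range s)) = carrier (cstar_generated C' (range S)) \<and>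
             (\<forall>x. h (s x) = S x)))"

definition cuntz_isometries :: "('u, 'r) cstar_scheme \<Rightarrow> ('n::finite \<Rightarrow> 'u) \<Rightarrow> bool" where
  "cuntz_isometries A v \<longleftrightarrow>
     (\<forall>i. v i \<in> carrier A) \<and>
     (\<forall>i. star A (v i) \<otimes>\<^bsub>A\<^esub> v i = \<one>\<^bsub>A\<^esub>) \<and>
     (\<Oplus>\<^bsub>A\<^esub>i\<in>UNIV. v i \<otimes>\<^bsub>A\<^esub> star A (v i)) = \<one>\<^bsub>A\<^esub>"

definition cuntz_algebra :: "'u cstar \<Rightarrow> ('n::finite \<Rightarrow> 'u) \<Rightarrow> bool" where
  "cuntz_algebra K v \<longleftrightarrow>
     unital_cstar_algebra K \<and> cuntz_isometries K v \<and>
     carrier (cstar_generated K (range v)) = carrier K \<and>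
     (\<forall>(A :: 'u cstar) w. unital_cstar_algebra A \<and> cuntz_isometries A w \<longrightarrow>
        (\<exists>h. unital_star_hom K A h \<and> (\<forall>i. h (v i) = w i)))"

section \<open>The tensor constructions on elementary tensors\<close>

lemma vector_space_bscale: "vector_space (bscale :: complex \<Rightarrow> ('d::finite, 'n::finite) blocks \<Rightarrow> _)"
  by unfold_locales (auto simp: bscale_def vec_eq_iff algebra_simps)

lemma blocks_expand:
  fixes x :: "('d::finite, 'n::finite) blocks"
  shows "x = (\<Sum>(a, i, j)\<in>UNIV. bscale (x $ a $ i $ j) (std_unit a i j))"
proof -
  have "(\<Sum>(a, i, j)\<in>UNIV. bscale (x $ a $ i $ j) (std_unit a i j)) $ b $ k $ l = x $ b $ k $ l"
    for b k l
  proof -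
    have "(\<Sum>(a, i, j)\<in>UNIV. bscale (x $ a $ i $ j) (std_unit a i j)) $ b $ k $ l
        = (\<Sum>p\<in>UNIV. bscale (x $ fst p $ fst (snd p) $ snd (snd p))
            (std_unit (fst p) (fst (snd p)) (snd (snd p))) $ b $ k $ l)"
      by (simp add: sum_component case_prod_unfold)
    also have "\<dots> = (\<Sum>p\<in>UNIV. if p = (b, k, l) then x $ b $ k $ l else 0)"
      by (rule sum.cong) (auto simp: bscale_def std_unit_def)
    finally show ?thesis by simp
  qed
  then show ?thesis by (simp add: vec_eq_iff)
qed

lemma tensor_functional_tensor:
  assumes "Vector_Spaces.linear bscale (*) \<phi>" and "Vector_Spaces.linear bscale (*) \<omega>"
  shows "tensor_functional \<phi> \<omega> (tensor x y) = \<phi> x * \<omega> y"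
proof -
  interpret p: Vector_Spaces.linear bscale "(*)" \<phi> by fact
  interpret q: Vector_Spaces.linear bscale "(*)" \<omega> by fact
  have x: "\<phi> x = (\<Sum>(a, i, j)\<in>UNIV. x $ a $ i $ j * \<phi> (std_unit a i j))"
    by (subst blocks_expand[of x]) (simp add: p.sum p.scale case_prod_unfold)
  have y: "\<omega> y = (\<Sum>(a, i, j)\<in>UNIV. y $ a $ i $ j * \<omega> (std_unit a i j))"
    by (subst blocks_expand[of y]) (simp add: q.sum q.scale case_prod_unfold)
  show ?thesis
    unfolding x y sum_product tensor_functional_def
    by (simp add: tensor_def case_prod_unfold mult_ac)
qed

lemma bilinear_expand:
  fixes \<beta> :: "('d::finite, 'n::finite) blocks \<Rightarrow> ('e::finite, 'm::finite) blocks
    \<Rightarrow> ('f::finite, 'k::finite) blocks"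
  assumes l: "\<And>y. blinear (\<lambda>x. \<beta> x y)" and r: "\<And>x. blinear (\<beta> x)"
  shows "(\<Sum>(a, i, j)\<in>UNIV. \<Sum>(b, k, l)\<in>UNIV.
      bscale (tensor x y $ (a, b) $ (i, k) $ (j, l)) (\<beta> (std_unit a i j) (std_unit b k l))) = \<beta> x y"
proof -
  have 1: "\<beta> x y = (\<Sum>(a, i, j)\<in>UNIV. bscale (x $ a $ i $ j) (\<beta> (std_unit a i j) y))"
  proof -
    interpret p: Vector_Spaces.linear bscale bscale "\<lambda>x. \<beta> x y" by (rule l)
    show ?thesis
      by (subst blocks_expand[of x]) (simp add: p.sum p.scale case_prod_unfold)
  qed
  have 2: "\<beta> z y = (\<Sum>(b, k, l)\<in>UNIV. bscale (y $ b $ k $ l) (\<beta> z (std_unit b k l)))" for z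
  proof -
    interpret p: Vector_Spaces.linear bscale bscale "\<beta> z" by (rule r)
    show ?thesis
      by (subst blocks_expand[of y]) (simp add: p.sum p.scale case_prod_unfold)
  qed
  interpret b: vector_space "bscale :: complex \<Rightarrow> ('f, 'k) blocks \<Rightarrow> _"
    by (rule vector_space_bscale)
  show ?thesis
    by (subst 1, subst 2)
       (simp add: b.scale_sum_right case_prod_unfold tensor_def)
qed

lemma tensor_map_tensor:
  assumes F: "blinear F" and G: "blinear G"
  shows "tensor_map F G (tensor x y) = tensor (F x) (G y)"
proof -
  interpret F: Vector_Spaces.linear bscale bscale F by fact
  interpret G: Vector_Spaces.linear bscale bscale G by fact
  show ?thesis
    unfolding tensor_map_def
    by (rule bilinear_expand; unfold_locales)
       (auto simp: F.add F.scale G.add G.scale,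
        auto simp: tensor_def bscale_def vec_eq_iff algebra_simps)
qed

lemma mult_map_tensor: "mult_map (tensor x y) = bmult x y"
  unfolding mult_map_def
  by (rule bilinear_expand; unfold_locales)
     (auto simp: bmult_def bscale_def vec_eq_iff matrix_matrix_mult_def algebra_simps
        sum.distrib sum_distrib_left)

lemma linear_into_sum:
  assumes C: "unital_cstar_algebra C" and S: "linear_into C S" and "finite I"
  shows "S (\<Sum>i\<in>I. f i) = (\<Oplus>\<^bsub>C\<^esub>i\<in>I. S (f i))"
proof -
  interpret unital_cstar_algebra C by fact
  have c: "S x \<in> carrier C" for x using S by (simp add: linear_into_def)
  have a: "S (x + y) = S x \<oplus>\<^bsub>C\<^esub> S y" for x y using S by (simp add: linear_into_def)
  have "S 0 \<oplus>\<^bsub>C\<^esub> S 0 = S 0" using a[of 0 0] by simp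
  then have z: "S 0 = \<zero>\<^bsub>C\<^esub>" using c by (metis l_neg r_neg1)
  from \<open>finite I\<close> show ?thesis
    by (induction I) (auto simp: z a c)
qed

lemma mu_tensor_tensor:
  assumes C: "unital_cstar_algebra C" and S: "linear_into C S" and T: "linear_into C T"
  shows "mu_tensor C S T (tensor x y) = S x \<otimes>\<^bsub>C\<^esub> T y"
proof -
  interpret unital_cstar_algebra C by fact
  have c: "S x \<in> carrier C" "T y \<in> carrier C" for x y
    using S T by (simp_all add: linear_into_def)
  have x: "S x = finsum C (\<lambda>(a, i, j). scale C (x $ a $ i $ j) (S (std_unit a i j))) UNIV"
    using S by (subst blocks_expand[of x])
      (simp add: linear_into_sum[OF C S] case_prod_unfold linear_into_def)
  have y: "T y = finsum C (\<lambda>(a, i, j). scale C (y $ a $ i $ j) (T (std_unit a i j))) UNIV"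
    using T by (subst blocks_expand[of y])
      (simp add: linear_into_sum[OF C T] case_prod_unfold linear_into_def)
  show ?thesis
    unfolding x mu_tensor_def
    by (subst finsum_ldistr)
       (auto simp: c scale_closed y finsum_rdistr scale_mult_left scale_mult_right
          scale_scale mult.commute case_prod_unfold tensor_def Pi_def intro!: finsum_cong')
qed

end

theory Submission
  imports Defs
begin

text \<open>
  Put \<open>w a i = \<psi> (e a i i) > 0\<close>. Evaluated on the matrix units, where the adjoint of the
  multiplication is \<open>e_ij \<mapsto> \<Sum>_r w_r\<inverse> e_ir \<otimes> e_rj\<close>, the three axioms of a family for the dephasing
  graph become plain relations between the elements \<open>t_ij = \<delta> w_j^(-1/2) S (e_ij)\<close>
  (\<open>lqck_family_iff\<close>): these are partial isometries with pairwise orthogonal range projections that sum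
  to 1, and the source projection of \<open>t_ji\<close> is \<open>P_i = \<Sum>_r t_ir t_ir*\<close>, so that the \<open>P_i\<close> over all blocks
  are orthogonal projections with sum 1. Hence in \<open>V_i* V_i\<close> and in \<open>\<Sum>_i V_i V_i*\<close> all mixed products
  vanish, the remaining ones sum to \<open>\<Sum> P_i = 1\<close>, and the \<open>V_i\<close> are Cuntz isometries
  (\<open>dephasing_relations_cuntz\<close>).

  The universal property of the Cuntz algebra then gives a unital homomorphism \<open>\<pi>\<close> with
  \<open>\<pi> (v_i) = V_i\<close>. It is injective because it has a left inverse. In the Cuntz
  algebra itself the elements \<open>v_i v_j v_j*\<close> in one chosen block, and 0 in all
  other blocks, satisfy the relations, and their sum over \<open>j\<close> and the blocks is \<open>v_i\<close>
  (\<open>cuntz_dephasing_relations\<close>). By universality of \<open>s\<close> there is a homomorphism \<open>h\<close> with \<open>h (V_i) = v_i\<close>.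
  So \<open>h \<circ> \<pi>\<close> fixes the generators \<open>v_i\<close>; since *-homomorphisms are continuous, it is the identity.

  Two facts about C*-algebras enter, and both come directly from the C*-identity. Homomorphisms are
  contractive (\<open>star_hom_contractive\<close>): a self-adjoint element of norm less than 1 is the real part of a
  unitary, and homomorphisms map unitaries into the unit ball. The range projections of Cuntz isometries,
  being projections with sum 1, are orthogonal (\<open>cuntz_isometries_orthogonal\<close>): this rests on the fact
  that a sum of positive elements vanishes only if each of them does, and that in turn on the unit being
  an extreme point of the unit ball.
\<close>

section \<open>Calculus in unital C*-algebras\<close>

abbreviation cstar_lim :: "('u, 'r) cstar_scheme \<Rightarrow> (nat \<Rightarrow> 'u) \<Rightarrow> 'u \<Rightarrow> bool" where
  "cstar_lim A X x \<equiv> (\<lambda>k. cnorm A (X k \<ominus>\<^bsub>A\<^esub> x)) \<longlonglongrightarrow> 0"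

context unital_cstar_algebra
begin

lemma scale_zero_left: "x \<in> carrier A \<Longrightarrow> scale A 0 x = \<zero>"
  using scale_add_left[of x 0 0] scale_closed[of x 0] by simp

lemma scale_zero: "scale A c \<zero> = \<zero>"
  using scale_add_right[of \<zero> \<zero> c] scale_closed[of \<zero> c] by simp

lemma star_zero: "star A \<zero> = \<zero>"
  using star_add[of \<zero> \<zero>] star_closed[of \<zero>] by simp

lemma star_one: "star A \<one> = \<one>"
  using star_mult[of "star A \<one>" \<one>] star_closed[of \<one>] by (simp add: star_star)

lemma minus_eq_scale: "x \<in> carrier A \<Longrightarrow> \<ominus> x = scale A (- 1) x"
  using scale_add_left[of x "- 1" 1] scale_closed[of x "- 1"]
  by (intro minus_equality) (auto simp: scale_zero_left scale_one)

lemma diff_eq_scale: "x \<in> carrier A \<Longrightarrow> y \<in> carrier A \<Longrightarrow> x \<ominus> y = x \<oplus> scale A (- 1) y"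
  by (simp add: a_minus_def minus_eq_scale)

lemma scale_cancel:
  "c \<noteq> 0 \<Longrightarrow> x \<in> carrier A \<Longrightarrow> y \<in> carrier A \<Longrightarrow> scale A c x = scale A c y \<longleftrightarrow> x = y"
  by (metis scale_scale scale_one left_inverse)

lemma scale_finsum:
  "finite I \<Longrightarrow> (\<And>i. i \<in> I \<Longrightarrow> f i \<in> carrier A) \<Longrightarrow>
    scale A c (\<Oplus>i\<in>I. f i) = (\<Oplus>i\<in>I. scale A c (f i))"
  by (induction I rule: finite_induct) (auto simp: scale_zero scale_add_right scale_closed Pi_def)

lemma star_finsum:
  "finite I \<Longrightarrow> (\<And>i. i \<in> I \<Longrightarrow> f i \<in> carrier A) \<Longrightarrow>
    star A (\<Oplus>i\<in>I. f i) = (\<Oplus>i\<in>I. star A (f i))"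
  by (induction I rule: finite_induct) (auto simp: star_zero star_add star_closed Pi_def)

lemma finsum_delta:
  assumes "finite I" "k \<in> I" "x \<in> carrier A"
  shows "(\<Oplus>i\<in>I. if i = k then x else \<zero>) = x"
  using add.finprod_singleton_swap[of k I "\<lambda>_. x"] assms by (simp add: Pi_def)

lemma cnorm_zero: "cnorm A \<zero> = 0"
  by (simp add: cnorm_eq_zero)

lemma cnorm_minus: "x \<in> carrier A \<Longrightarrow> cnorm A (\<ominus> x) = cnorm A x"
  by (simp add: minus_eq_scale cnorm_scale)

lemma cnorm_diff_sym:
  assumes "x \<in> carrier A" "y \<in> carrier A"
  shows "cnorm A (x \<ominus> y) = cnorm A (y \<ominus> x)"
  using cnorm_minus[of "x \<ominus> y"] assms by (simp add: a_minus_def minus_add a_comm)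

lemma cnorm_diff_triangle:
  assumes "x \<in> carrier A" "y \<in> carrier A" "z \<in> carrier A"
  shows "cnorm A (x \<ominus> z) \<le> cnorm A (x \<ominus> y) + cnorm A (y \<ominus> z)"
proof -
  have "x \<ominus> z = (x \<ominus> y) \<oplus> (y \<ominus> z)"
    using assms by (simp add: a_minus_def a_assoc r_neg1)
  then show ?thesis
    using cnorm_triangle[of "x \<ominus> y" "y \<ominus> z"] assms by simp
qed

lemma diff_zero_iff: "x \<in> carrier A \<Longrightarrow> y \<in> carrier A \<Longrightarrow> x \<ominus> y = \<zero> \<longleftrightarrow> x = y"
  by (metis a_minus_def minus_equality minus_minus r_neg a_inv_closed)

lemma cnorm_star:
  assumes "x \<in> carrier A"
  shows "cnorm A (star A x) = cnorm A x"
proof -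
  have *: "cnorm A x \<le> cnorm A (star A x)" if "x \<in> carrier A" for x
  proof (cases "cnorm A x = 0")
    case False
    have "(cnorm A x)\<^sup>2 \<le> cnorm A (star A x) * cnorm A x"
      using cnorm_mult[of "star A x" x] that by (simp add: cstar_identity star_closed)
    then show ?thesis using False cnorm_nonneg[OF that]
      by (simp add: power2_eq_square)
  qed (simp add: cnorm_nonneg star_closed that)
  show ?thesis using *[OF assms] *[OF star_closed[OF assms]] assms by (simp add: star_star)
qed

lemma projection_cnorm_le_one:
  assumes "x \<in> carrier A" "star A x = x" "x \<otimes> x = x"
  shows "cnorm A x \<le> 1"
proof -
  have "(cnorm A x)\<^sup>2 = cnorm A x"
    using cstar_identity[OF assms(1)] by (simp add: assms)
  then have "cnorm A x = 0 \<or> cnorm A x = 1"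
    by (simp add: power2_eq_square)
  then show ?thesis by auto
qed

lemma cnorm_one_le: "cnorm A \<one> \<le> 1"
  by (rule projection_cnorm_le_one) (simp_all add: star_one)

lemma lim_unique:
  assumes "\<And>k. X k \<in> carrier A" "x \<in> carrier A" "y \<in> carrier A" "cstar_lim A X x" "cstar_lim A X y"
  shows "x = y"
proof -
  have "cnorm A (x \<ominus> y) \<le> 0"
  proof (rule LIMSEQ_le_const)
    show "(\<lambda>k. cnorm A (X k \<ominus> x) + cnorm A (X k \<ominus> y)) \<longlonglongrightarrow> 0"
      using tendsto_add[OF assms(4,5)] by simp
    show "\<exists>N. \<forall>n\<ge>N. cnorm A (x \<ominus> y) \<le> cnorm A (X n \<ominus> x) + cnorm A (X n \<ominus> y)"
      using cnorm_diff_triangle[of x _ y] cnorm_diff_sym[of x] assms(1-3) by metis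
  qed
  then show ?thesis
    using cnorm_nonneg[of "x \<ominus> y"] cnorm_eq_zero[of "x \<ominus> y"] assms(2,3) by (simp add: diff_zero_iff)
qed

lemma lim_squeeze:
  assumes "\<And>k. X k \<in> carrier A" "x \<in> carrier A"
    and "\<And>k. cnorm A (X k \<ominus> x) \<le> f k" and "f \<longlonglongrightarrow> 0"
  shows "cstar_lim A X x"
  by (rule tendsto_sandwich[OF _ _ tendsto_const assms(4)])
     (auto intro!: always_eventually cnorm_nonneg assms)

lemma lim_add:
  assumes "\<And>k. X k \<in> carrier A" "x \<in> carrier A" "\<And>k. Y k \<in> carrier A" "y \<in> carrier A"
    and "cstar_lim A X x" "cstar_lim A Y y"
  shows "cstar_lim A (\<lambda>k. X k \<oplus> Y k) (x \<oplus> y)"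
proof (rule lim_squeeze)
  show "(\<lambda>k. cnorm A (X k \<ominus> x) + cnorm A (Y k \<ominus> y)) \<longlonglongrightarrow> 0"
    using tendsto_add[OF assms(5,6)] by simp
  fix k
  have "X k \<oplus> Y k \<ominus> (x \<oplus> y) = (X k \<ominus> x) \<oplus> (Y k \<ominus> y)"
    using assms(1-4) by (simp add: a_minus_def minus_add a_ac)
  then show "cnorm A (X k \<oplus> Y k \<ominus> (x \<oplus> y)) \<le> cnorm A (X k \<ominus> x) + cnorm A (Y k \<ominus> y)"
    using cnorm_triangle[of "X k \<ominus> x" "Y k \<ominus> y"] assms(1-4) by simp
qed (use assms in auto)

lemma lim_scale:
  assumes "\<And>k. X k \<in> carrier A" "x \<in> carrier A" "cstar_lim A X x"
  shows "cstar_lim A (\<lambda>k. scale A c (X k)) (scale A c x)"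
proof (rule lim_squeeze)
  show "(\<lambda>k. cmod c * cnorm A (X k \<ominus> x)) \<longlonglongrightarrow> 0"
    using tendsto_mult_right_zero[OF assms(3)] by simp
  fix k
  have "scale A c (X k) \<ominus> scale A c x = scale A c (X k \<ominus> x)"
    using assms(1,2) by (simp add: diff_eq_scale scale_closed scale_add_right scale_scale)
  then show "cnorm A (scale A c (X k) \<ominus> scale A c x) \<le> cmod c * cnorm A (X k \<ominus> x)"
    using assms(1,2) by (simp add: cnorm_scale)
qed (use assms in \<open>auto simp: scale_closed\<close>)

lemma lim_star:
  assumes "\<And>k. X k \<in> carrier A" "x \<in> carrier A" "cstar_lim A X x"
  shows "cstar_lim A (\<lambda>k. star A (X k)) (star A x)"
proof (rule lim_squeeze)
  fix k
  have "star A (X k) \<ominus> star A x = star A (X k \<ominus> x)"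
    using assms(1,2) by (simp add: diff_eq_scale scale_closed star_closed star_add star_scale)
  then show "cnorm A (star A (X k) \<ominus> star A x) \<le> cnorm A (X k \<ominus> x)"
    using assms(1,2) by (simp add: cnorm_star)
qed (use assms in \<open>auto simp: star_closed\<close>)

lemma mult_diff_split:
  assumes "x \<in> carrier A" "y \<in> carrier A" "x' \<in> carrier A" "y' \<in> carrier A"
  shows "x \<otimes> y \<ominus> x' \<otimes> y' = (x \<ominus> x') \<otimes> y \<oplus> x' \<otimes> (y \<ominus> y')"
  using assms by (simp add: a_minus_def l_distr r_distr l_minus r_minus a_assoc r_neg1)

lemma cnorm_mult_diff_le:
  assumes "x \<in> carrier A" "y \<in> carrier A" "x' \<in> carrier A" "y' \<in> carrier A"
  shows "cnorm A (x \<otimes> y \<ominus> x' \<otimes> y')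
    \<le> cnorm A (x \<ominus> x') * cnorm A y + cnorm A x' * cnorm A (y \<ominus> y')"
  unfolding mult_diff_split[OF assms]
  using cnorm_triangle[of "(x \<ominus> x') \<otimes> y" "x' \<otimes> (y \<ominus> y')"]
    cnorm_mult[of "x \<ominus> x'" y] cnorm_mult[of x' "y \<ominus> y'"] assms by simp

lemma lim_mult:
  assumes "\<And>k. X k \<in> carrier A" "x \<in> carrier A" "\<And>k. Y k \<in> carrier A" "y \<in> carrier A"
    and "cstar_lim A X x" "cstar_lim A Y y"
  shows "cstar_lim A (\<lambda>k. X k \<otimes> Y k) (x \<otimes> y)"
proof (rule lim_squeeze)
  let ?f = "\<lambda>k. cnorm A (X k \<ominus> x) * (cnorm A (Y k \<ominus> y) + cnorm A y) + cnorm A x * cnorm A (Y k \<ominus> y)"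
  have "?f \<longlonglongrightarrow> 0 * (0 + cnorm A y) + cnorm A x * 0"
    by (intro tendsto_intros assms)
  then show "?f \<longlonglongrightarrow> 0" by simp
  fix k
  have "cnorm A (Y k) \<le> cnorm A (Y k \<ominus> y) + cnorm A y"
    using cnorm_triangle[of "Y k \<ominus> y" y] assms by (simp add: a_minus_def a_assoc l_neg)
  then have "cnorm A (X k \<ominus> x) * cnorm A (Y k)
      \<le> cnorm A (X k \<ominus> x) * (cnorm A (Y k \<ominus> y) + cnorm A y)"
    using assms by (intro mult_left_mono cnorm_nonneg) auto
  then show "cnorm A (X k \<otimes> Y k \<ominus> x \<otimes> y) \<le> ?f k"
    using cnorm_mult_diff_le[of "X k" "Y k" x y] assms by simp
qed (use assms in auto)

lemma lim_const: "x \<in> carrier A \<Longrightarrow> cstar_lim A (\<lambda>k. x) x"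
  by (simp add: a_minus_def r_neg cnorm_zero)

section \<open>Contractivity of *-homomorphisms\<close>

text \<open>
  The element \<open>g = 1 - p\<close> is a square root of \<open>1 - y\<^sup>2\<close> exactly if \<open>p = (y\<^sup>2 + p\<^sup>2) / 2\<close>.
  On the ball of radius \<open>r = \<parallel>y\<parallel> < 1\<close> the right hand side is a contraction with constant \<open>r\<close>,
  so the fixed point is found by iteration from 0; all iterates are self-adjoint and commute with \<open>y\<close>,
  and so does their limit.
\<close>

lemma sqrt_one_minus_square:
  assumes y: "y \<in> carrier A" "star A y = y" and less: "cnorm A y < 1"
  obtains g where "g \<in> carrier A" "star A g = g" "y \<otimes> g = g \<otimes> y" "y \<otimes> y \<oplus> g \<otimes> g = \<one>"
proof -
  define r where "r = cnorm A y"
  have r: "0 \<le> r" "r < 1" using less y by (auto simp: r_def cnorm_nonneg)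
  define F where "F q = scale A (1/2) (y \<otimes> y \<oplus> q \<otimes> q)" for q
  define q where "q k = (F ^^ k) \<zero>" for k
  have q_Suc: "q (Suc k) = F (q k)" for k by (simp add: q_def)
  have F: "F x \<in> carrier A" if "x \<in> carrier A" for x
    using that y by (simp add: F_def scale_closed)
  have q: "q k \<in> carrier A" for k
    by (induction k) (auto simp: q_Suc F, simp add: q_def)
  have yy: "cnorm A (y \<otimes> y) \<le> r * r"
    using cnorm_mult[of y y] y by (simp add: r_def)
  have q_le: "cnorm A (q k) \<le> r" for k
  proof (induction k)
    case 0
    then show ?case using r by (simp add: q_def cnorm_zero)
  next
    case (Suc k)
    have "cnorm A (q k \<otimes> q k) \<le> r * r"
      using cnorm_mult[of "q k" "q k"] Suc q r cnorm_nonneg[OF q]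
      by (meson mult_mono order_trans)
    then have "cnorm A (y \<otimes> y \<oplus> q k \<otimes> q k) \<le> 2 * (r * r)"
      using cnorm_triangle[of "y \<otimes> y" "q k \<otimes> q k"] yy y q by simp
    then have "cnorm A (q (Suc k)) \<le> r * r"
      using y q by (simp add: q_Suc F_def cnorm_scale)
    then show ?case using r by (meson mult_left_le order_trans less_imp_le)
  qed
  have step: "cnorm A (F x \<ominus> F z) \<le> r * cnorm A (x \<ominus> z)"
    if c: "x \<in> carrier A" "z \<in> carrier A" and l: "cnorm A x \<le> r" "cnorm A z \<le> r" for x z
  proof -
    have "F x \<ominus> F z = scale A (1/2) (x \<otimes> x \<ominus> z \<otimes> z)"
    proof -
      have "F x \<ominus> F z = scale A (1/2) ((y \<otimes> y \<oplus> x \<otimes> x) \<ominus> (y \<otimes> y \<oplus> z \<otimes> z))"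
        using y c by (simp add: F_def diff_eq_scale scale_closed scale_add_right scale_scale)
      also have "(y \<otimes> y \<oplus> x \<otimes> x) \<ominus> (y \<otimes> y \<oplus> z \<otimes> z) = x \<otimes> x \<ominus> z \<otimes> z"
        using y c by (simp add: a_minus_def minus_add a_ac r_neg1 r_neg2)
      finally show ?thesis .
    qed
    then have "cnorm A (F x \<ominus> F z) = 1/2 * cnorm A (x \<otimes> x \<ominus> z \<otimes> z)"
      using c by (simp add: cnorm_scale)
    also have "\<dots> \<le> 1/2 * (cnorm A (x \<ominus> z) * cnorm A x + cnorm A z * cnorm A (x \<ominus> z))"
      using cnorm_mult_diff_le[of x x z z] c by simp
    also have "\<dots> \<le> 1/2 * (cnorm A (x \<ominus> z) * r + r * cnorm A (x \<ominus> z))"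
      using l c by (intro mult_left_mono add_mono mult_right_mono cnorm_nonneg) auto
    finally show ?thesis by simp
  qed
  \<comment> \<open>\<open>q (k + p)\<close> and \<open>q k\<close> are the \<open>k\<close>-th iterates of \<open>q p\<close> and \<open>q 0 = 0\<close>\<close>
  have cauchy: "cnorm A (q (k + p) \<ominus> q k) \<le> r ^ k" for k p
  proof (induction k)
    case 0
    have "q p \<ominus> q 0 = q p" using q by (simp add: q_def a_minus_def)
    then show ?case using q_le[of p] r by simp
  next
    case (Suc k)
    have "cnorm A (q (Suc k + p) \<ominus> q (Suc k)) \<le> r * cnorm A (q (k + p) \<ominus> q k)"
      using step[of "q (k + p)" "q k"] q q_le by (simp add: q_Suc)
    also have "\<dots> \<le> r * r ^ k" using Suc r by (intro mult_left_mono)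
    finally show ?case by simp
  qed
  have pow0: "(\<lambda>k. r ^ k) \<longlonglongrightarrow> 0" using r by (simp add: LIMSEQ_power_zero)
  have "\<exists>N. \<forall>k\<ge>N. \<forall>l\<ge>N. cnorm A (q k \<ominus> q l) < \<epsilon>" if "\<epsilon> > 0" for \<epsilon>
  proof -
    have "eventually (\<lambda>k. r ^ k < \<epsilon>) sequentially" using order_tendstoD(2)[OF pow0 that] .
    then obtain N where N: "\<And>k. k \<ge> N \<Longrightarrow> r ^ k < \<epsilon>" by (auto simp: eventually_sequentially)
    have *: "cnorm A (q l \<ominus> q k) < \<epsilon>" if "k \<ge> N" "l \<ge> k" for k l
      using cauchy[of k "l - k"] N[OF that(1)] that(2) by simp
    show ?thesis
      by (rule exI[of _ N]) (metis * cnorm_diff_sym q nle_le)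
  qed
  then obtain p where p: "p \<in> carrier A" "cstar_lim A q p"
    using cnorm_complete[of q] q by blast
  have commute: "F x \<otimes> y = y \<otimes> F x" if "x \<in> carrier A" "x \<otimes> y = y \<otimes> x" for x
  proof -
    have "x \<otimes> x \<otimes> y = y \<otimes> (x \<otimes> x)"
      using that y by (metis m_assoc)
    then show ?thesis
      using that y by (simp add: F_def scale_mult_left scale_mult_right l_distr r_distr m_assoc)
  qed
  have qy: "q k \<otimes> y = y \<otimes> q k" for k
    using y by (induction k) (auto simp: q_Suc commute q, simp add: q_def)
  have qs: "star A (q k) = q k" for k
  proof (induction k)
    case 0 then show ?case by (simp add: q_def star_zero)
  next
    case (Suc k)
    then show ?case using y q
      by (simp add: q_Suc F_def star_scale star_add star_mult)
  qed
  have py: "p \<otimes> y = y \<otimes> p"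
  proof (rule lim_unique)
    show "cstar_lim A (\<lambda>k. q k \<otimes> y) (p \<otimes> y)"
      by (intro lim_mult lim_const p q y)
    show "cstar_lim A (\<lambda>k. q k \<otimes> y) (y \<otimes> p)"
      unfolding qy by (intro lim_mult lim_const p q y)
  qed (use p q y in auto)
  have ps: "star A p = p"
    by (rule lim_unique[of q]) (use lim_star[OF q p] p q in \<open>auto simp: qs star_closed\<close>)
  have pF: "p = F p"
  proof (rule lim_unique)
    show "cstar_lim A (\<lambda>k. q (Suc k)) p"
      using LIMSEQ_Suc[OF p(2)] .
    show "cstar_lim A (\<lambda>k. q (Suc k)) (F p)"
      unfolding q_Suc unfolding F_def
      by (intro lim_scale lim_add lim_mult lim_const p q y m_closed a_closed)
  qed (use p q F in auto)
  have p2: "p \<oplus> p = y \<otimes> y \<oplus> p \<otimes> p"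
  proof -
    have "p \<oplus> p = scale A 2 (F p)"
      using p scale_add_left[of p 1 1] by (simp flip: pF add: scale_one)
    then show ?thesis using y p by (simp add: F_def scale_scale scale_one)
  qed
  let ?g = "\<one> \<ominus> p"
  have g: "?g \<in> carrier A" using p by simp
  have "star A ?g = ?g"
    using p by (simp add: diff_eq_scale star_add star_scale star_one ps scale_closed)
  moreover have "y \<otimes> ?g = ?g \<otimes> y"
    using p y by (simp add: a_minus_def r_distr l_distr r_minus l_minus py)
  moreover have "y \<otimes> y \<oplus> ?g \<otimes> ?g = \<one>"
  proof -
    have "?g \<otimes> ?g = \<one> \<ominus> (p \<oplus> p) \<oplus> p \<otimes> p"
      using p by (simp add: a_minus_def r_distr l_distr r_minus l_minus minus_add a_ac)
    then have "?g \<otimes> ?g = \<one> \<ominus> (y \<otimes> y)"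
      using p y by (simp add: p2 a_minus_def minus_add a_assoc l_neg)
    then show ?thesis using y by (simp add: a_minus_def a_ac r_neg1 r_neg)
  qed
  ultimately show ?thesis using that g by blast
qed

end

text \<open>
  For self-adjoint \<open>y\<close> with \<open>\<parallel>y\<parallel> < 1\<close> the element \<open>u = y + i g\<close>, where \<open>g\<close> is the square root of
  \<open>1 - y\<^sup>2\<close>, satisfies \<open>u* u = 1\<close>. So \<open>\<parallel>h u\<parallel>\<^sup>2 = \<parallel>h 1\<parallel> \<le> 1\<close>, as \<open>h 1\<close> is a projection, and \<open>h y\<close> is the
  real part of \<open>h u\<close>. The general case follows by scaling and from the C*-identity for \<open>x* x\<close>.
\<close>

theorem star_hom_contractive:
  assumes A: "unital_cstar_algebra A" and A': "unital_cstar_algebra A'"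
    and h: "star_hom A A' h" and x: "x \<in> carrier A"
  shows "cnorm A' (h x) \<le> cnorm A x"
proof -
  interpret A: unital_cstar_algebra A by fact
  interpret A': unital_cstar_algebra A' by fact
  have hc: "h x \<in> carrier A'" if "x \<in> carrier A" for x
    using h that by (simp add: star_hom_def)
  have ha: "h (x \<oplus>\<^bsub>A\<^esub> y) = h x \<oplus>\<^bsub>A'\<^esub> h y" and hm: "h (x \<otimes>\<^bsub>A\<^esub> y) = h x \<otimes>\<^bsub>A'\<^esub> h y"
    if "x \<in> carrier A" "y \<in> carrier A" for x y
    using h that by (simp_all add: star_hom_def)
  have hs: "h (star A x) = star A' (h x)" and hsc: "h (scale A c x) = scale A' c (h x)"
    if "x \<in> carrier A" for x c
    using h that by (simp_all add: star_hom_def)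
  have h1: "cnorm A' (h \<one>\<^bsub>A\<^esub>) \<le> 1"
    using hs[of "\<one>\<^bsub>A\<^esub>"] hm[of "\<one>\<^bsub>A\<^esub>" "\<one>\<^bsub>A\<^esub>"]
    by (intro A'.projection_cnorm_le_one) (simp_all add: A.star_one hc)
  have unit_ball: "cnorm A' (h y) \<le> 1"
    if y: "y \<in> carrier A" "star A y = y" "cnorm A y < 1" for y
  proof -
    obtain g where g: "g \<in> carrier A" "star A g = g" "y \<otimes>\<^bsub>A\<^esub> g = g \<otimes>\<^bsub>A\<^esub> y"
      "y \<otimes>\<^bsub>A\<^esub> y \<oplus>\<^bsub>A\<^esub> g \<otimes>\<^bsub>A\<^esub> g = \<one>\<^bsub>A\<^esub>"
      using A.sqrt_one_minus_square y by blast
    define u where "u = y \<oplus>\<^bsub>A\<^esub> scale A \<i> g"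
    have u: "u \<in> carrier A" using y g by (simp add: u_def A.scale_closed)
    have su: "star A u = y \<oplus>\<^bsub>A\<^esub> scale A (-\<i>) g"
      using y g by (simp add: u_def A.star_add A.star_scale A.scale_closed)
    have "star A u \<otimes>\<^bsub>A\<^esub> u = (y \<otimes>\<^bsub>A\<^esub> y \<oplus>\<^bsub>A\<^esub> scale A (-\<i>) (g \<otimes>\<^bsub>A\<^esub> y)) \<oplus>\<^bsub>A\<^esub>
       (scale A \<i> (g \<otimes>\<^bsub>A\<^esub> y) \<oplus>\<^bsub>A\<^esub> g \<otimes>\<^bsub>A\<^esub> g)"
      unfolding su unfolding u_def
      using y(1) g(1,3) by (simp add: A.l_distr A.r_distr A.scale_closed A.scale_mult_left A.scale_mult_right
           A.scale_scale A.scale_one A.scale_add_right)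
    also have "\<dots> = (y \<otimes>\<^bsub>A\<^esub> y \<oplus>\<^bsub>A\<^esub> g \<otimes>\<^bsub>A\<^esub> g) \<oplus>\<^bsub>A\<^esub>
        (scale A (-\<i>) (g \<otimes>\<^bsub>A\<^esub> y) \<oplus>\<^bsub>A\<^esub> scale A \<i> (g \<otimes>\<^bsub>A\<^esub> y))"
      using y(1) g(1) by (simp add: A.a_ac A.scale_closed)
    also have "\<dots> = \<one>\<^bsub>A\<^esub>"
      using y(1) g(1) by (simp add: g(4) A.scale_zero_left flip: A.scale_add_left)
    finally have uu: "star A u \<otimes>\<^bsub>A\<^esub> u = \<one>\<^bsub>A\<^esub>" .
    have "(cnorm A' (h u))\<^sup>2 = cnorm A' (h \<one>\<^bsub>A\<^esub>)"
      using A'.cstar_identity[of "h u"] u by (simp add: hc A.star_closed flip: hs hm uu)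
    then have hu: "cnorm A' (h u) \<le> 1"
      using h1 by (metis abs_le_square_iff abs_one one_power2 power_one abs_le_D1)
    have "scale A (1/2) (u \<oplus>\<^bsub>A\<^esub> star A u) = y"
    proof -
      have "u \<oplus>\<^bsub>A\<^esub> star A u = (y \<oplus>\<^bsub>A\<^esub> y) \<oplus>\<^bsub>A\<^esub> (scale A \<i> g \<oplus>\<^bsub>A\<^esub> scale A (-\<i>) g)"
        unfolding su unfolding u_def using y(1) g(1) by (simp add: A.a_ac A.scale_closed)
      also have "\<dots> = scale A 2 y"
        using y(1) g(1) A.scale_add_left[of y 1 1]
        by (simp add: A.scale_one A.scale_zero_left flip: A.scale_add_left)
      finally show ?thesis using y by (simp add: A.scale_scale A.scale_one)
    qed
    then have "h y = scale A' (1/2) (h u \<oplus>\<^bsub>A'\<^esub> star A' (h u))"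
      using u by (metis hsc hs ha A.star_closed A.a_closed)
    then have "cnorm A' (h y) = 1/2 * cnorm A' (h u \<oplus>\<^bsub>A'\<^esub> star A' (h u))"
      using hc[OF u] by (simp add: A'.cnorm_scale A'.star_closed)
    also have "\<dots> \<le> 1/2 * (cnorm A' (h u) + cnorm A' (h u))"
      using A'.cnorm_triangle[of "h u" "star A' (h u)"] hc[OF u]
      by (simp add: A'.star_closed A'.cnorm_star)
    finally show ?thesis using hu by simp
  qed
  have sa: "cnorm A' (h y) \<le> cnorm A y" if y: "y \<in> carrier A" "star A y = y" for y
  proof (rule field_le_epsilon)
    fix \<epsilon> :: real assume \<epsilon>: "\<epsilon> > 0"
    define r where "r = cnorm A y + \<epsilon>"
    have r: "r > 0" "cnorm A y < r" using \<epsilon> A.cnorm_nonneg[OF y(1)] by (simp_all add: r_def)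
    have "cnorm A' (h (scale A (of_real (1/r)) y)) \<le> 1"
      by (rule unit_ball) (use y r in \<open>simp_all add: A.scale_closed A.star_scale A.cnorm_scale norm_divide\<close>)
    then have "cnorm A' (h y) \<le> r"
      using y r by (simp add: hsc A'.cnorm_scale hc norm_divide divide_le_eq)
    then show "cnorm A' (h y) \<le> cnorm A y + \<epsilon>" by (simp add: r_def)
  qed
  have "(cnorm A' (h x))\<^sup>2 = cnorm A' (h (star A x \<otimes>\<^bsub>A\<^esub> x))"
    using x by (simp add: hm hs A.star_closed A'.cstar_identity hc)
  also have "\<dots> \<le> cnorm A (star A x \<otimes>\<^bsub>A\<^esub> x)"
    using x by (intro sa) (simp_all add: A.star_closed A.star_mult A.star_star)
  also have "\<dots> = (cnorm A x)\<^sup>2" using x by (rule A.cstar_identity)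
  finally show ?thesis using A.cnorm_nonneg[OF x] by (rule power2_le_imp_le)
qed

section \<open>The C*-algebra generated by a subset\<close>

lemma unital_cstar_subalgebra:
  assumes "unital_cstar_algebra A" and H: "cstar_subalgebra A H" and one: "\<one>\<^bsub>A\<^esub> \<in> H"
  shows "unital_cstar_algebra (A\<lparr>carrier := H\<rparr>)"
proof -
  interpret unital_cstar_algebra A by fact
  let ?B = "A\<lparr>carrier := H\<rparr>"
  have sub: "x \<in> carrier A" if "x \<in> H" for x using H that by (auto simp: cstar_subalgebra_def)
  have closed: "\<zero>\<^bsub>A\<^esub> \<in> H" "\<And>x y. x \<in> H \<Longrightarrow> y \<in> H \<Longrightarrow> x \<oplus>\<^bsub>A\<^esub> y \<in> H"
    "\<And>x y. x \<in> H \<Longrightarrow> y \<in> H \<Longrightarrow> x \<otimes>\<^bsub>A\<^esub> y \<in> H" "\<And>x. x \<in> H \<Longrightarrow> star A x \<in> H"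
    "\<And>c x. x \<in> H \<Longrightarrow> scale A c x \<in> H"
    using H by (simp_all add: cstar_subalgebra_def)
  have lim: "x \<in> H" if "\<And>k. X k \<in> H" "x \<in> carrier A" "cstar_lim A X x" for X x
    using H that unfolding cstar_subalgebra_def by blast
  have inv: "scale A (-1) x \<oplus>\<^bsub>A\<^esub> x = \<zero>\<^bsub>A\<^esub>" if "x \<in> carrier A" for x
    using l_neg[OF that] minus_eq_scale[OF that] by simp
  interpret B: ring ?B
  proof (rule ringI)
    show "abelian_group ?B"
    proof (rule abelian_groupI)
      fix x assume "x \<in> carrier ?B"
      then show "\<exists>y\<in>carrier ?B. y \<oplus>\<^bsub>?B\<^esub> x = \<zero>\<^bsub>?B\<^esub>"
        using inv[of x] closed(5)[of x "-1"] by (intro bexI[of _ "scale A (-1) x"]) (simp_all add: sub)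
    qed (simp_all add: closed sub a_ac)
    show "monoid ?B"
      by (rule monoidI) (auto simp: closed one sub m_assoc)
  qed (auto simp: sub l_distr r_distr)
  have minus: "\<ominus>\<^bsub>?B\<^esub> x = \<ominus>\<^bsub>A\<^esub> x" if "x \<in> H" for x
    using that inv[OF sub[OF that]] closed(5)[OF that, of "-1"]
    by (intro B.minus_equality) (simp_all add: minus_eq_scale[OF sub[OF that]])
  have diff: "x \<ominus>\<^bsub>?B\<^esub> y = x \<ominus>\<^bsub>A\<^esub> y" if "y \<in> H" for x y
    using that by (simp add: a_minus_def minus)
  show ?thesis
  proof (unfold_locales, goal_cases)
    case (19 X)
    have "\<exists>x\<in>carrier A. cstar_lim A X x"
    proof (rule cnorm_complete)
      show "X k \<in> carrier A" for k using 19(1) by (simp add: sub)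
      show "\<exists>N. \<forall>k\<ge>N. \<forall>l\<ge>N. cnorm A (X k \<ominus>\<^bsub>A\<^esub> X l) < \<epsilon>" if "\<epsilon> > 0" for \<epsilon>
        using 19(2)[OF that] 19(1) by (simp add: diff)
    qed
    then obtain x where x: "x \<in> carrier A" "cstar_lim A X x" by blast
    have "x \<in> H" using 19(1) by (intro lim[OF _ x]) simp
    then show ?case using x by (intro bexI[of _ x]) (simp_all add: diff)
  qed (simp_all add: closed sub scale_add_right scale_add_left scale_scale scale_one scale_mult_left
      scale_mult_right star_star star_add star_scale star_mult cnorm_nonneg cnorm_eq_zero
      cnorm_triangle cnorm_scale cnorm_mult cstar_identity)
qed

context unital_cstar_algebra
begin

lemma cstar_subalgebra_generated:
  assumes "X \<subseteq> carrier A"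
  shows "cstar_subalgebra A (carrier (cstar_generated A X))"
proof -
  let ?F = "{H. cstar_subalgebra A H \<and> X \<subseteq> H}"
  have "carrier A \<in> ?F"
    using assms by (auto simp: cstar_subalgebra_def scale_closed star_closed)
  then have sub: "\<Inter>?F \<subseteq> carrier A" by blast
  have H: "H \<in> ?F \<Longrightarrow> \<zero> \<in> H \<and> (\<forall>x\<in>H. \<forall>y\<in>H. x \<oplus> y \<in> H \<and> x \<otimes> y \<in> H) \<and>
     (\<forall>x\<in>H. star A x \<in> H \<and> (\<forall>c. scale A c x \<in> H))" for H
    by (simp add: cstar_subalgebra_def)
  have lim: "x \<in> H" if "H \<in> ?F" "\<forall>k. Y k \<in> H" "x \<in> carrier A" "cstar_lim A Y x" for H Y x
    using that unfolding cstar_subalgebra_def by blast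
  have "cstar_subalgebra A (\<Inter>?F)"
    unfolding cstar_subalgebra_def[of A "\<Inter>?F"]
  proof (intro conjI ballI allI impI)
    show "x \<in> \<Inter>?F" if "(\<forall>k. Y k \<in> \<Inter>?F) \<and> x \<in> carrier A \<and> cstar_lim A Y x" for Y x
      using that lim[of _ Y x] by blast
  qed (use sub H in \<open>simp_all\<close>)
  then show ?thesis by (simp add: cstar_generated_def)
qed

lemma generated_subset: "X \<subseteq> carrier (cstar_generated A X)"
  by (auto simp: cstar_generated_def)

lemma generated_least: "cstar_subalgebra A H \<Longrightarrow> X \<subseteq> H \<Longrightarrow> carrier (cstar_generated A X) \<subseteq> H"
  by (auto simp: cstar_generated_def)

lemma finsum_subalgebra:
  assumes "unital_cstar_algebra (A\<lparr>carrier := H\<rparr>)" "H \<subseteq> carrier A" "finite I"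
    and "\<And>i. i \<in> I \<Longrightarrow> f i \<in> H"
  shows "finsum (A\<lparr>carrier := H\<rparr>) f I = finsum A f I"
proof -
  interpret B: unital_cstar_algebra "A\<lparr>carrier := H\<rparr>" by fact
  show ?thesis using assms(3,4)
  proof (induction I rule: finite_induct)
    case (insert i I)
    then have "f \<in> I \<rightarrow> H" "f \<in> I \<rightarrow> carrier A" "f i \<in> carrier A" using assms(2) by auto
    with insert show ?case by simp
  qed simp
qed

end

lemma star_hom_finsum:
  assumes "unital_cstar_algebra A" "unital_cstar_algebra A'" "star_hom A A' h" "finite I"
    and "\<And>i. i \<in> I \<Longrightarrow> f i \<in> carrier A"
  shows "h (finsum A f I) = finsum A' (\<lambda>i. h (f i)) I"
proof -
  interpret A: unital_cstar_algebra A by fact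
  interpret A': unital_cstar_algebra A' by fact
  have c: "h x \<in> carrier A'" if "x \<in> carrier A" for x using assms(3) that by (simp add: star_hom_def)
  have a: "h (x \<oplus>\<^bsub>A\<^esub> y) = h x \<oplus>\<^bsub>A'\<^esub> h y" if "x \<in> carrier A" "y \<in> carrier A" for x y
    using assms(3) that by (simp add: star_hom_def)
  have z: "h \<zero>\<^bsub>A\<^esub> = \<zero>\<^bsub>A'\<^esub>" using a[of "\<zero>\<^bsub>A\<^esub>" "\<zero>\<^bsub>A\<^esub>"] c[of "\<zero>\<^bsub>A\<^esub>"] by simp
  show ?thesis using assms(4,5)
    by (induction I rule: finite_induct) (auto simp: z a c Pi_def)
qed

section \<open>Positivity\<close>

context unital_cstar_algebra
begin

lemma cnorm_mult_le_one:
  assumes "x \<in> carrier A" "y \<in> carrier A" "cnorm A x \<le> 1" "cnorm A y \<le> 1"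
  shows "cnorm A (x \<otimes> y) \<le> 1"
  using cnorm_mult[OF assms(1,2)] mult_mono[OF assms(3,4)] cnorm_nonneg assms(1,2) by simp

lemma cnorm_convex_le_one:
  assumes "x \<in> carrier A" "y \<in> carrier A" "cnorm A x \<le> 1" "cnorm A y \<le> 1" "0 \<le> l" "l \<le> 1"
  shows "cnorm A (scale A (of_real l) x \<oplus> scale A (of_real (1 - l)) y) \<le> 1"
proof -
  have "cnorm A (scale A (of_real l) x \<oplus> scale A (of_real (1 - l)) y)
      \<le> l * cnorm A x + (1 - l) * cnorm A y"
    using cnorm_triangle[of "scale A (of_real l) x" "scale A (of_real (1 - l)) y"] assms(1,2,5,6)
    by (simp add: scale_closed cnorm_scale del: of_real_diff)
  also have "\<dots> \<le> l * 1 + (1 - l) * 1"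
    using assms by (intro add_mono mult_left_mono) auto
  finally show ?thesis by simp
qed

text \<open>
  One step of the proof that 1 is an extreme point of the unit ball: from \<open>1 + c\<close> and \<open>1 - c\<close> in the ball
  one gets \<open>1 + (3/2) c\<close> in the ball. The ball is convex and closed under products, so it contains
  \<open>1 + 3 c\<^sup>2\<close>, the mean of \<open>(1 + c)^3\<close> and \<open>(1 - c)^3\<close>. As \<open>1 + 3 c\<^sup>2 = z* z\<close> for
  \<open>z = 1 \<plusminus> i \<surd>3 c\<close>, the C*-identity puts both these \<open>z\<close> into the ball, hence also \<open>1 - 3 c\<^sup>2\<close>, the mean of
  their squares. Finally \<open>1 + (3/2) c = (3/4) (1 + c)\<^sup>2 + (1/4) (1 - 3 c\<^sup>2)\<close>.
\<close>

lemma extreme_unit_step: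
  assumes c: "c \<in> carrier A" "star A c = c"
    and plus: "cnorm A (\<one> \<oplus> c) \<le> 1" and minus: "cnorm A (\<one> \<oplus> scale A (- 1) c) \<le> 1"
  shows "cnorm A (\<one> \<oplus> scale A (3/2) c) \<le> 1"
proof -
  \<comment> \<open>polynomials in \<open>c\<close> of degree at most 3, by their coefficients\<close>
  define p where "p k0 k1 k2 k3 = scale A k0 \<one> \<oplus> (scale A k1 c \<oplus>
    (scale A k2 (c \<otimes> c) \<oplus> scale A k3 (c \<otimes> (c \<otimes> c))))" for k0 k1 k2 k3
  have p: "p k0 k1 k2 k3 \<in> carrier A" for k0 k1 k2 k3
    using c by (simp add: p_def scale_closed)
  have p_add: "p a b d f \<oplus> p a' b' d' f' = p (a + a') (b + b') (d + d') (f + f')"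
    for a b d f a' b' d' f'
    using c by (simp add: p_def scale_closed scale_add_left a_ac)
  have p_scale: "scale A z (p a b d f) = p (z * a) (z * b) (z * d) (z * f)" for z a b d f
    using c by (simp add: p_def scale_closed scale_add_right scale_scale)
  have p_mult: "p a b d 0 \<otimes> p a' b' 0 0 = p (a * a') (a * b' + b * a') (b * b' + d * a') (d * b')"
    for a b d a' b'
    using c by (simp add: p_def scale_closed scale_zero_left l_distr r_distr scale_mult_left
      scale_mult_right scale_scale scale_add_left scale_add_right m_assoc a_ac mult.commute)
  have p_star: "star A (p a b 0 0) = p (cnj a) (cnj b) 0 0" for a b
    using c by (simp add: p_def scale_closed scale_zero_left star_add star_scale star_one)
  have p_lin: "p 1 b 0 0 = \<one> \<oplus> scale A b c" for b
    using c by (simp add: p_def scale_closed scale_zero_left scale_one)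
  have half: "cnorm A (p ((a + a') / 2) ((b + b') / 2) ((d + d') / 2) ((f + f') / 2)) \<le> 1"
    if "cnorm A (p a b d f) \<le> 1" "cnorm A (p a' b' d' f') \<le> 1" for a b d f a' b' d' f'
    using cnorm_convex_le_one[OF p p that, of "1/2"]
    by (simp add: p_scale p_add add_divide_distrib)
  have n1: "cnorm A (p 1 1 0 0) \<le> 1" "cnorm A (p 1 (- 1) 0 0) \<le> 1"
    using plus minus c by (simp_all add: p_lin scale_one)
  have n2: "cnorm A (p 1 2 1 0) \<le> 1" "cnorm A (p 1 (- 2) 1 0) \<le> 1"
    using cnorm_mult_le_one[OF p p n1(1) n1(1)] cnorm_mult_le_one[OF p p n1(2) n1(2)]
    by (simp_all add: p_mult)
  have n3: "cnorm A (p 1 3 3 1) \<le> 1" "cnorm A (p 1 (- 3) 3 (- 1)) \<le> 1"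
    using cnorm_mult_le_one[OF p p n2(1) n1(1)] cnorm_mult_le_one[OF p p n2(2) n1(2)]
    by (simp_all add: p_mult)
  have even: "cnorm A (p 1 0 3 0) \<le> 1" using half[OF n3] by simp
  define s where "s = \<i> * of_real (sqrt 3)"
  have s: "s * s = - 3" "cnj s = - s"
    by (simp_all add: s_def algebra_simps flip: of_real_mult)
  have skew: "cnorm A (p 1 z 0 0) \<le> 1" if z: "z = s \<or> z = - s" for z
  proof -
    have "(cnorm A (p 1 z 0 0))\<^sup>2 = cnorm A (p 1 0 3 0)"
      using cstar_identity[OF p[of 1 z 0 0]] z by (auto simp: p_star p_mult s)
    then have "(cnorm A (p 1 z 0 0))\<^sup>2 \<le> 1\<^sup>2" using even by simp
    then show ?thesis by (rule power2_le_imp_le) simp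
  qed
  have "cnorm A (p 1 (2 * s) (- 3) 0) \<le> 1" "cnorm A (p 1 (- 2 * s) (- 3) 0) \<le> 1"
    using cnorm_mult_le_one[OF p p skew skew, of s s] cnorm_mult_le_one[OF p p skew skew, of "- s" "- s"]
    by (simp_all add: p_mult s)
  from half[OF this] have "cnorm A (p 1 0 (- 3) 0) \<le> 1" by simp
  from cnorm_convex_le_one[OF p p n2(1) this, of "3/4"]
  show ?thesis by (simp add: p_scale p_add p_lin)
qed

text \<open>
  Iterating the step, \<open>1 \<plusminus> (3/2)^n c\<close> stays in the unit ball for all \<open>n\<close>, which is only possible for \<open>c = 0\<close>.
\<close>

lemma extreme_unit:
  assumes c: "c \<in> carrier A" "star A c = c"
    and plus: "cnorm A (\<one> \<oplus> c) \<le> 1" and minus: "cnorm A (\<one> \<ominus> c) \<le> 1"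
  shows "c = \<zero>"
proof -
  define x where "x n = scale A (of_real ((3/2) ^ n)) c" for n
  have x: "x n \<in> carrier A" "star A (x n) = x n" for n
    using c by (simp_all add: x_def scale_closed star_scale)
  have x_Suc: "x (Suc n) = scale A (3/2) (x n)" for n
    using c by (simp add: x_def scale_scale)
  have ball: "cnorm A (\<one> \<oplus> x n) \<le> 1 \<and> cnorm A (\<one> \<oplus> scale A (- 1) (x n)) \<le> 1" for n
  proof (induction n)
    case 0
    show ?case using plus minus c by (simp add: x_def scale_one diff_eq_scale)
  next
    case (Suc n)
    have "cnorm A (\<one> \<oplus> scale A (3/2) (scale A (- 1) (x n))) \<le> 1"
      using Suc x by (intro extreme_unit_step) (simp_all add: scale_closed star_scale scale_scale scale_one)
    moreover have "scale A (3/2) (scale A (- 1) (x n)) = scale A (- 1) (x (Suc n))"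
      using x by (simp add: x_Suc scale_scale)
    ultimately show ?case
      using extreme_unit_step[OF x] Suc by (simp add: x_Suc)
  qed
  have "(3/2) ^ n * cnorm A c \<le> 1" for n
  proof -
    have "scale A (of_real (1/2)) (\<one> \<oplus> x n) \<oplus> scale A (of_real (1 - 1/2)) (scale A (- 1) (\<one> \<oplus> scale A (- 1) (x n)))
      = (scale A (1/2) \<one> \<oplus> scale A (- (1/2)) \<one>) \<oplus> (scale A (1/2) (x n) \<oplus> scale A (1/2) (x n))"
      using x by (simp add: scale_add_right scale_closed scale_scale a_ac)
    also have "\<dots> = x n"
      using x by (simp add: scale_one scale_zero_left flip: scale_add_left)
    finally have "cnorm A (x n) \<le> 1"
      using cnorm_convex_le_one[of "\<one> \<oplus> x n" "scale A (- 1) (\<one> \<oplus> scale A (- 1) (x n))" "1/2"] ball[of n] x[of n]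
      by (simp add: scale_closed cnorm_scale)
    then show ?thesis using c by (simp add: x_def cnorm_scale norm_power)
  qed
  moreover have "\<exists>n. 1 / cnorm A c < (3/2) ^ n" by (rule real_arch_pow) simp
  ultimately have "\<not> cnorm A c > 0" by (metis linorder_not_less pos_divide_less_eq)
  then show ?thesis using cnorm_nonneg[OF c(1)] cnorm_eq_zero[OF c(1)] by simp
qed

text \<open>
  Here \<open>\<parallel>1 - a\<parallel> \<le> 1\<close> stands for positivity of the self-adjoint element \<open>a\<close>. With \<open>M = card I\<close>, the
  triangle inequality gives \<open>\<parallel>M 1 - a_j\<parallel> \<le> M\<close> and \<open>\<parallel>M 1 + a_j\<parallel> \<le> M\<close>, the latter because \<open>- a_j\<close> is the
  sum of the other terms; so \<open>1 \<plusminus> a_j / M\<close> lie in the unit ball.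
\<close>

lemma sum_positive_eq_zero:
  assumes "finite I" and a: "\<And>i. i \<in> I \<Longrightarrow> a i \<in> carrier A" "\<And>i. i \<in> I \<Longrightarrow> star A (a i) = a i"
    and pos: "\<And>i. i \<in> I \<Longrightarrow> cnorm A (\<one> \<ominus> a i) \<le> 1"
    and sum: "(\<Oplus>i\<in>I. a i) = \<zero>" and j: "j \<in> I"
  shows "a j = \<zero>"
proof -
  have bound: "cnorm A (scale A (of_real M) \<one> \<ominus> (\<Oplus>i\<in>R. a i)) \<le> M"
    if "finite R" "R \<subseteq> I" "real (card R) \<le> M" for R M
    using that
  proof (induction R arbitrary: M rule: finite_induct)
    case empty
    then show ?case using mult_left_mono[OF cnorm_one_le, of M]
      by (simp add: a_minus_def scale_closed cnorm_scale)
  next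
    case (insert i R)
    have c: "a i \<in> carrier A" "(\<Oplus>i\<in>R. a i) \<in> carrier A"
      using insert.prems a by (auto intro!: finsum_closed)
    have "scale A (of_real M) \<one> = scale A (of_real (M - 1)) \<one> \<oplus> \<one>"
      using scale_add_left[of \<one> "of_real (M - 1)" 1] by (simp add: scale_one)
    moreover have "(\<Oplus>i\<in>insert i R. a i) = a i \<oplus> (\<Oplus>i\<in>R. a i)"
      using insert a by (subst finsum_insert) auto
    ultimately have "scale A (of_real M) \<one> \<ominus> (\<Oplus>i\<in>insert i R. a i)
        = (\<one> \<ominus> a i) \<oplus> (scale A (of_real (M - 1)) \<one> \<ominus> (\<Oplus>i\<in>R. a i))"
      using c by (simp add: a_minus_def minus_add a_ac scale_closed)
    moreover have "cnorm A (scale A (of_real (M - 1)) \<one> \<ominus> (\<Oplus>i\<in>R. a i)) \<le> M - 1"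
      using insert by (intro insert.IH) auto
    moreover have "cnorm A (\<one> \<ominus> a i) \<le> 1" using insert.prems by (intro pos) auto
    ultimately show ?case
      using cnorm_triangle[of "\<one> \<ominus> a i" "scale A (of_real (M - 1)) \<one> \<ominus> (\<Oplus>i\<in>R. a i)"] c
      by (simp add: scale_closed)
  qed
  define M where "M = real (card I)"
  have M: "M \<ge> 1" using \<open>finite I\<close> j by (auto simp: M_def Suc_le_eq card_gt_0_iff)
  have c: "a j \<in> carrier A" "(\<Oplus>i\<in>I - {j}. a i) \<in> carrier A"
    using a j by (auto intro!: finsum_closed)
  have "(\<Oplus>i\<in>insert j (I - {j}). a i) = a j \<oplus> (\<Oplus>i\<in>I - {j}. a i)"
    using a j \<open>finite I\<close> by (subst finsum_insert) auto
  then have "a j \<oplus> (\<Oplus>i\<in>I - {j}. a i) = \<zero>"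
    using j sum by (simp add: insert_absorb)
  then have rest: "\<ominus> (\<Oplus>i\<in>I - {j}. a i) = a j" using c by (simp add: minus_equality)
  let ?c = "scale A (of_real (1 / M)) (a j)"
  have one: "\<one> = scale A (of_real (1 / M)) (scale A (of_real M) \<one>)"
    using M by (simp add: scale_scale scale_one)
  have "cnorm A (\<one> \<ominus> ?c) \<le> 1"
  proof -
    have "\<one> \<ominus> ?c = scale A (of_real (1 / M)) (scale A (of_real M) \<one> \<ominus> (\<Oplus>i\<in>{j}. a i))"
      using c by (subst one) (simp add: diff_eq_scale scale_closed scale_add_right scale_scale)
    then show ?thesis using bound[of "{j}" M] M j c
      by (simp add: cnorm_scale scale_closed norm_divide divide_le_eq)
  qed
  moreover have "cnorm A (\<one> \<oplus> ?c) \<le> 1"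
  proof -
    have "\<one> \<oplus> ?c = scale A (of_real (1 / M)) (scale A (of_real M) \<one> \<ominus> (\<Oplus>i\<in>I - {j}. a i))"
      using c by (subst one) (simp add: a_minus_def rest scale_closed scale_add_right)
    moreover have "real (card (I - {j})) \<le> M"
      unfolding M_def using \<open>finite I\<close> by (simp add: card_mono)
    ultimately show ?thesis using bound[of "I - {j}" M] M c \<open>finite I\<close>
      by (simp add: cnorm_scale scale_closed norm_divide divide_le_eq)
  qed
  moreover have "?c \<in> carrier A" "star A ?c = ?c"
    using c a j by (simp_all add: scale_closed star_scale)
  ultimately have "?c = \<zero>" using extreme_unit[of ?c] by blast
  then show ?thesis
    using M c scale_cancel[of "of_real (1 / M)" "a j" \<zero>] by (simp add: scale_zero)
qed

section \<open>Cuntz isometries\<close>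

text \<open>
  For \<open>i \<noteq> j\<close> the reason is \<open>\<Sum>_k v_k v_k* = 1\<close>. Multiplying this with \<open>v_j*\<close> and
  \<open>v_j\<close>, and removing the term \<open>k = j\<close>, which is 1, shows that the positive elements \<open>v_j* v_k v_k* v_j\<close> with \<open>k \<noteq> j\<close> sum to 0. So each of them is 0, and it is the
  absolute square of \<open>v_k* v_j\<close>.
\<close>

lemma cuntz_isometries_orthogonal:
  assumes v: "cuntz_isometries A v"
  shows "star A (v i) \<otimes> v j = (if i = j then \<one> else \<zero>)"
proof (cases "i = j")
  case True
  then show ?thesis using v by (simp add: cuntz_isometries_def)
next
  case False
  have vc [simp]: "v k \<in> carrier A" "star A (v k) \<in> carrier A" for k
    using v by (simp_all add: cuntz_isometries_def star_closed)
  have iso: "star A (v k) \<otimes> v k = \<one>" for k using v by (simp add: cuntz_isometries_def)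
  define p where "p k = v k \<otimes> star A (v k)" for k
  have p [simp]: "p k \<in> carrier A" for k by (simp add: p_def)
  have pp: "p k \<otimes> p k = p k" "star A (p k) = p k" for k
  proof -
    have "p k \<otimes> p k = v k \<otimes> (star A (v k) \<otimes> v k) \<otimes> star A (v k)" by (simp add: p_def m_assoc)
    then show "p k \<otimes> p k = p k" by (simp add: iso p_def)
    show "star A (p k) = p k" by (simp add: p_def star_mult star_star)
  qed
  have v_norm: "cnorm A (v k) \<le> 1" for k
  proof -
    have "(cnorm A (v k))\<^sup>2 \<le> 1\<^sup>2" using cstar_identity[of "v k"] cnorm_one_le by (simp add: iso)
    then show ?thesis by (rule power2_le_imp_le) simp
  qed
  have compl: "cnorm A (\<one> \<ominus> p k) \<le> 1" for k
  proof -
    have "star A (\<one> \<ominus> p k) = \<one> \<ominus> p k"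
      by (simp add: diff_eq_scale star_add star_scale scale_closed star_one pp)
    moreover have "(\<one> \<ominus> p k) \<otimes> (\<one> \<ominus> p k) = \<one> \<ominus> p k"
      by (simp add: a_minus_def l_distr r_distr l_minus r_minus pp a_assoc r_neg)
    ultimately show ?thesis by (intro projection_cnorm_le_one) simp_all
  qed
  define a where "a k = star A (v j) \<otimes> (p k \<otimes> v j)" for k
  have a [simp]: "a k \<in> carrier A" for k by (simp add: a_def)
  have aj: "a j = \<one>"
    using iso[of j] by (simp add: a_def p_def m_assoc)
  have "(\<Oplus>k\<in>UNIV. a k) = star A (v j) \<otimes> ((\<Oplus>k\<in>UNIV. p k) \<otimes> v j)"
    by (simp add: a_def finsum_ldistr finsum_rdistr)
  also have "\<dots> = \<one>"
    using v by (simp add: cuntz_isometries_def p_def iso)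
  finally have "(\<Oplus>k\<in>insert j (UNIV - {j}). a k) = \<one>" by (simp add: insert_absorb)
  then have "\<one> \<oplus> (\<Oplus>k\<in>UNIV - {j}. a k) = \<one>"
    by (subst (asm) finsum_insert) (auto simp: aj)
  then have "(\<Oplus>k\<in>UNIV - {j}. a k) = \<zero>"
    using add.l_cancel_one[of \<one> "\<Oplus>k\<in>UNIV - {j}. a k"] by simp
  moreover have "cnorm A (\<one> \<ominus> a k) \<le> 1" for k
  proof -
    have "\<one> \<ominus> a k = star A (v j) \<otimes> ((\<one> \<ominus> p k) \<otimes> v j)"
      by (simp add: a_def a_minus_def l_distr r_distr l_minus r_minus iso)
    then show ?thesis
      using cnorm_mult_le_one[of "star A (v j)" "(\<one> \<ominus> p k) \<otimes> v j"]
        cnorm_mult_le_one[of "\<one> \<ominus> p k" "v j"] v_norm compl by (simp add: cnorm_star)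
  qed
  moreover have "star A (a k) = a k" for k
    by (simp add: a_def star_mult star_star pp m_assoc)
  ultimately have "a i = \<zero>"
    using False by (intro sum_positive_eq_zero[of "UNIV - {j}" a i]) auto
  then have "star A (star A (v i) \<otimes> v j) \<otimes> (star A (v i) \<otimes> v j) = \<zero>"
    by (simp add: a_def p_def star_mult star_star m_assoc)
  then have "star A (v i) \<otimes> v j = \<zero>"
    using cstar_identity[of "star A (v i) \<otimes> v j"] cnorm_eq_zero[of "star A (v i) \<otimes> v j"]
    by (simp add: cnorm_zero)
  with False show ?thesis by simp
qed

end

section \<open>Matrix units and tensor products\<close>

interpretation blocks: vector_space "bscale :: complex \<Rightarrow> ('d::finite, 'n::finite) blocks \<Rightarrow> _"
  by (rule vector_space_bscale)

lemma blinear_iff: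
  fixes f :: "('d::finite, 'n::finite) blocks \<Rightarrow> ('e::finite, 'm::finite) blocks"
  shows "blinear f \<longleftrightarrow> (\<forall>x y. f (x + y) = f x + f y) \<and> (\<forall>c x. f (bscale c x) = bscale c (f x))"
  by (simp add: Vector_Spaces.linear_iff vector_space_bscale)

lemma functional_iff:
  fixes f :: "('d::finite, 'n::finite) blocks \<Rightarrow> complex"
  shows "Vector_Spaces.linear bscale (*) f \<longleftrightarrow>
    (\<forall>x y. f (x + y) = f x + f y) \<and> (\<forall>c x. f (bscale c x) = c * f x)"
proof -
  have "vector_space ((*) :: complex \<Rightarrow> complex \<Rightarrow> complex)"
    by unfold_locales (auto simp: algebra_simps)
  then show ?thesis by (simp add: Vector_Spaces.linear_iff vector_space_bscale)
qed

lemma bmult_linear: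
  "bmult (x + y) z = bmult x z + bmult y z" "bmult z (x + y) = bmult z x + bmult z y"
  "bmult (bscale c x) z = bscale c (bmult x z)" "bmult z (bscale c x) = bscale c (bmult z x)"
  "bmult 0 z = 0" "bmult z 0 = 0"
  by (simp_all add: bmult_def bscale_def vec_eq_iff matrix_matrix_mult_def algebra_simps
      sum.distrib sum_distrib_left)

lemma bstar_linear:
  "bstar (x + y) = bstar x + bstar y" "bstar (bscale c x) = bscale (cnj c) (bstar x)" "bstar 0 = 0"
  by (simp_all add: bstar_def bscale_def vec_eq_iff)

lemma bstar_bstar: "bstar (bstar x) = x"
  by (simp add: bstar_def vec_eq_iff)

lemma tensor_linear:
  "tensor (x + y) z = tensor x z + tensor y z" "tensor z (x + y) = tensor z x + tensor z y"
  "tensor (bscale c x) z = bscale c (tensor x z)" "tensor z (bscale c x) = bscale c (tensor z x)"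
  "tensor 0 z = 0" "tensor z 0 = 0"
  by (simp_all add: tensor_def bscale_def vec_eq_iff algebra_simps)

lemma tensor_sum:
  "tensor (\<Sum>i\<in>I. f i) z = (\<Sum>i\<in>I. tensor (f i) z)" "tensor z (\<Sum>i\<in>I. f i) = (\<Sum>i\<in>I. tensor z (f i))"
  by (induction I rule: infinite_finite_induct; simp add: tensor_linear)+

lemma bmult_tensor: "bmult (tensor x y) (tensor x' y') = tensor (bmult x x') (bmult y y')"
  by (simp add: bmult_def tensor_def vec_eq_iff matrix_matrix_mult_def sum_product
      sum.cartesian_product case_prod_unfold mult_ac)

lemma bstar_tensor: "bstar (tensor x y) = tensor (bstar x) (bstar y)"
  by (simp add: bstar_def tensor_def vec_eq_iff)

lemma tensor_bone: "tensor bone bone = bone"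
  by (auto simp: bone_def tensor_def vec_eq_iff mat_def prod_eq_iff)

lemma matrix_units_prod:
  assumes "matrix_units e"
  shows "bmult (e a i j) (e b k l) = (if a = b \<and> j = k then e a i l else 0)"
proof (cases "a = b")
  case True
  then show ?thesis using assms by (simp add: matrix_units_def)
next
  case False
  then have "e a i j $ c = 0 \<or> e b k l $ c = 0" for c
    using assms by (metis matrix_units_def)
  moreover have "A ** B = 0" if "A = 0 \<or> B = 0" for A B :: "complex^'c::finite^'c"
    using that by (auto simp: vec_eq_iff matrix_matrix_mult_def)
  ultimately have "e a i j $ c ** e b k l $ c = 0" for c by blast
  then have "bmult (e a i j) (e b k l) = 0"
    unfolding bmult_def by (subst vec_eq_iff) simp
  with False show ?thesis by simp
qed

text \<open>
  By cyclicity all \<open>e a i i\<close> of a block have the same trace there; since they sum to the unit of that block,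
  this trace is 1. In particular matrix units are nonzero.
\<close>

lemma trace_matrix_units:
  fixes e :: "'d::finite \<Rightarrow> 'n::finite \<Rightarrow> 'n \<Rightarrow> ('d, 'n) blocks"
  assumes e: "matrix_units e"
  shows "trace (e a i j $ b) = (if a = b \<and> i = j then 1 else 0)"
proof (cases "a = b")
  case True
  have cyc: "trace (bmult x y $ a) = trace (bmult y x $ a)" for x y :: "('d, 'n) blocks"
    unfolding bmult_def by (simp, rule trace_mul_sym)
  have diag: "trace (e a i i $ a) = trace (e a j j $ a)" for i j
    using cyc[of "e a i j" "e a j i"] by (simp add: matrix_units_prod[OF e])
  have off: "trace (e a i j $ a) = 0" if "i \<noteq> j"
    using cyc[of "e a i i" "e a i j"] that by (simp add: matrix_units_prod[OF e] trace_def)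
  have "(\<Sum>b\<in>UNIV. \<Sum>k\<in>UNIV. e b k k) $ a = mat 1"
    using e by (simp add: matrix_units_def bone_def)
  moreover have "(\<Sum>b\<in>UNIV. \<Sum>k\<in>UNIV. e b k k) $ a = (\<Sum>b\<in>UNIV. if b = a then \<Sum>k\<in>UNIV. e a k k $ a else 0)"
    unfolding sum_component using e by (intro sum.cong) (auto simp: matrix_units_def)
  ultimately have "(\<Sum>k\<in>UNIV. e a k k $ a) = mat 1" by simp
  moreover have "trace (\<Sum>k\<in>UNIV. e a k k $ a) = (\<Sum>k\<in>UNIV. trace (e a k k $ a))"
    by (simp add: trace_def sum_component) (rule sum.swap)
  ultimately have "(\<Sum>k\<in>UNIV. trace (e a k k $ a)) = of_nat CARD('n)"
    by (simp add: trace_I)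
  then have "of_nat CARD('n) * trace (e a i i $ a) = (of_nat CARD('n) :: complex)"
    by (subst (asm) diag[of _ i]) simp
  then have "trace (e a i i $ a) = 1" by simp
  with True off show ?thesis by auto
next
  case False
  then show ?thesis using e by (auto simp: matrix_units_def trace_def)
qed

lemma sum_delta_conj:
  "(\<Sum>j\<in>UNIV. if P \<and> j = l then f j else 0) = (if P then f (l :: 'a :: finite) else 0)"
  "(\<Sum>j\<in>UNIV. if P \<and> l = j then f j else 0) = (if P then f l else 0)"
  by (cases P; simp)+

text \<open>
  Every system of matrix units spans. The linear map \<open>T\<close> that replaces the standard units by the given ones
  is injective, since the traces recover the coefficients, and hence surjective by equality of dimensions.
\<close>

lemma matrix_units_induct:
  fixes e :: "'d::finite \<Rightarrow> 'n::finite \<Rightarrow> 'n \<Rightarrow> ('d, 'n) blocks"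
  assumes e: "matrix_units e"
    and add: "\<And>x y. P x \<Longrightarrow> P y \<Longrightarrow> P (x + y)"
    and scale: "\<And>c x. P x \<Longrightarrow> P (bscale c x)"
    and base: "\<And>a i j. P (e a i j)"
  shows "P x"
proof -
  define T :: "('d, 'n) blocks \<Rightarrow> ('d, 'n) blocks" where
    "T x = (\<Sum>p\<in>UNIV. bscale (x $ fst p $ fst (snd p) $ snd (snd p))
       (e (fst p) (fst (snd p)) (snd (snd p))))" for x
  define \<tau> :: "'d \<Rightarrow> ('d, 'n) blocks \<Rightarrow> complex" where "\<tau> a x = trace (x $ a)" for a x
  have \<tau>_sum: "\<tau> a (\<Sum>i\<in>I. f i) = (\<Sum>i\<in>I. \<tau> a (f i))" for a and f :: "'d \<times> 'n \<times> 'n \<Rightarrow> _" and I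
    by (simp add: \<tau>_def trace_def sum_component) (rule sum.swap)
  have \<tau>_scale: "\<tau> a (bscale c x) = c * \<tau> a x" for a c x
    by (simp add: \<tau>_def trace_def bscale_def sum_distrib_left)
  have \<tau>_unit: "\<tau> a (e b i j) = (if b = a \<and> i = j then 1 else 0)" for a b i j
    by (simp add: \<tau>_def trace_matrix_units[OF e])
  have \<tau>_zero: "\<tau> a 0 = 0" for a by (simp add: \<tau>_def trace_def)
  have T_coord: "\<tau> a (bmult (T x) (e a j i)) = x $ a $ i $ j" for x a i j
  proof -
    have m: "bmult (\<Sum>p\<in>I. f p) z = (\<Sum>p\<in>I. bmult (f p) z)" for f :: "'d \<times> 'n \<times> 'n \<Rightarrow> ('d, 'n) blocks" and I z
      by (induction I rule: infinite_finite_induct) (simp_all add: bmult_linear)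
    have "\<tau> a (bmult (T x) (e a j i)) = (\<Sum>p\<in>UNIV. if p = (a, i, j) then x $ a $ i $ j else 0)"
      unfolding T_def m \<tau>_sum
      by (rule sum.cong)
         (auto simp: bmult_linear \<tau>_scale matrix_units_prod[OF e] \<tau>_unit \<tau>_zero)
    then show ?thesis by simp
  qed
  have "linear T"
    by (rule linearI)
       (simp_all add: T_def bscale_def vec_eq_iff sum_component algebra_simps sum.distrib scaleR_sum_right
          scaleR_conv_of_real[where 'a=complex] sum_distrib_left)
  moreover have "inj T"
  proof (rule injI)
    fix x y assume xy: "T x = T y"
    have "x $ a $ i $ j = y $ a $ i $ j" for a i j
      using T_coord[of a x j i] T_coord[of a y j i] xy by simp
    then show "x = y" by (simp add: vec_eq_iff)
  qed
  ultimately have "surj T" by (rule linear_injective_imp_surjective) simp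
  then obtain y where x: "x = T y" by blast
  have zero: "P 0" using scale[OF base, of 0] by simp
  have sumP: "P (\<Sum>p\<in>I. f p)" if "\<And>p. P (f p)" for I and f :: "'d \<times> 'n \<times> 'n \<Rightarrow> _"
    by (induction I rule: infinite_finite_induct) (auto simp: zero add that)
  show ?thesis unfolding x T_def by (rule sumP, rule scale, rule base)
qed

lemma sum_UNIV_prod: "(\<Sum>p\<in>UNIV. f p) = (\<Sum>a\<in>UNIV. \<Sum>b\<in>UNIV. f (a, b))"
  for f :: "'a::finite \<times> 'b::finite \<Rightarrow> 'c::comm_monoid_add"
  by (simp add: sum.cartesian_product)

text \<open>
  This makes every fact about matrix units available on the tensor square as well.
\<close>

lemma matrix_units_tensor:
  assumes e: "matrix_units e" and f: "matrix_units f"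
  shows "matrix_units (\<lambda>p q r. tensor (e (fst p) (fst q) (fst r)) (f (snd p) (snd q) (snd r)))"
    (is "matrix_units ?E")
  unfolding matrix_units_def
proof (intro conjI allI impI)
  show "?E p i j $ q = 0" if "q \<noteq> p" for p q i j
    using that e f by (auto simp: matrix_units_def tensor_def vec_eq_iff prod_eq_iff)
  show "bmult (?E p i j) (?E p k l) = (if j = k then ?E p i l else 0)" for p i j k l
    by (auto simp: bmult_tensor matrix_units_prod[OF e] matrix_units_prod[OF f] tensor_linear prod_eq_iff)
  show "bstar (?E p i j) = ?E p j i" for p i j
    using e f by (simp add: bstar_tensor matrix_units_def)
  have "(\<Sum>p\<in>UNIV. \<Sum>i\<in>UNIV. ?E p i i) =
     (\<Sum>a\<in>UNIV. \<Sum>b\<in>UNIV. \<Sum>i\<in>UNIV. \<Sum>j\<in>UNIV. tensor (e a i i) (f b j j))"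
    by (simp add: sum_UNIV_prod)
  also have "\<dots> = tensor (\<Sum>a\<in>UNIV. \<Sum>i\<in>UNIV. e a i i) (\<Sum>b\<in>UNIV. \<Sum>j\<in>UNIV. f b j j)"
    unfolding tensor_sum(1) unfolding tensor_sum(2) by (intro sum.cong refl sum.swap)
  also have "\<dots> = bone"
    using e f by (simp add: matrix_units_def tensor_bone)
  finally show "(\<Sum>p\<in>UNIV. \<Sum>i\<in>UNIV. ?E p i i) = bone" .
qed

section \<open>The adjoint of the multiplication\<close>

lemma tensor_functional_linear: "Vector_Spaces.linear bscale (*) (tensor_functional \<phi> \<omega>)"
  by (simp add: functional_iff tensor_functional_def bscale_def case_prod_unfold algebra_simps
      sum.distrib sum_distrib_left)

lemma mult_map_linear: "blinear mult_map"
  by (simp add: blinear_iff mult_map_def bscale_def case_prod_unfold algebra_simps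
      sum.distrib sum_distrib_left vec_eq_iff sum_component)

lemma tensor_map_linear: "blinear (tensor_map F G)"
  by (simp add: blinear_iff tensor_map_def bscale_def case_prod_unfold algebra_simps
      sum.distrib sum_distrib_left vec_eq_iff sum_component)

text \<open>
  A faithful positive functional together with matrix units that diagonalise its density. Normalisation is
  left out; the tensor square of such a functional is again of this kind.
\<close>

locale diagonal_functional =
  fixes \<phi> :: "('d::finite, 'n::finite) blocks \<Rightarrow> complex"
    and e :: "'d \<Rightarrow> 'n \<Rightarrow> 'n \<Rightarrow> ('d, 'n) blocks"
    and w :: "'d \<Rightarrow> 'n \<Rightarrow> real"
  assumes units: "matrix_units e"
    and functional: "Vector_Spaces.linear bscale (*) \<phi>"
    and diagonal: "\<phi> (e a i j) = (if i = j then of_real (w a i) else 0)"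
    and weight_pos: "w a i > 0"
begin

lemmas prod = matrix_units_prod[OF units]

lemma bstar_unit: "bstar (e a i j) = e a j i"
  using units by (simp add: matrix_units_def)

lemma phi_linear: "\<phi> (x + y) = \<phi> x + \<phi> y" "\<phi> (bscale c x) = c * \<phi> x" "\<phi> 0 = 0"
proof -
  show "\<phi> (x + y) = \<phi> x + \<phi> y" and *: "\<phi> (bscale c x) = c * \<phi> x" for x y c
    using functional by (simp_all add: functional_iff)
  show "\<phi> 0 = 0" using *[of 0 0] by simp
qed

definition coord :: "'d \<Rightarrow> 'n \<Rightarrow> 'n \<Rightarrow> ('d, 'n) blocks \<Rightarrow> complex" where
  "coord a i j x = \<phi> (bmult x (e a j i)) / of_real (w a i)"

lemma coord_linear:
  "coord a i j (x + y) = coord a i j x + coord a i j y" "coord a i j (bscale c x) = c * coord a i j x"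
  by (simp_all add: coord_def bmult_linear phi_linear add_divide_distrib)

lemma coord_unit: "coord a i j (e b k l) = (if a = b \<and> i = k \<and> j = l then 1 else 0)"
  using weight_pos[of a i] by (auto simp: coord_def prod diagonal phi_linear)

lemma coord_expand: "x = (\<Sum>(a, i, j)\<in>UNIV. bscale (coord a i j x) (e a i j))"
proof (induction x rule: matrix_units_induct[OF units])
  case (1 x y)
  then show ?case
    by (simp add: coord_linear case_prod_unfold blocks.scale_left_distrib sum.distrib)
next
  case (2 c x)
  then show ?case
    by (simp add: coord_linear case_prod_unfold flip: blocks.scale_scale blocks.scale_sum_right)
next
  case (3 b k l)
  have "(\<Sum>(a, i, j)\<in>UNIV. bscale (coord a i j (e b k l)) (e a i j))
      = (\<Sum>p\<in>UNIV. if p = (b, k, l) then e b k l else 0)"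
    by (rule sum.cong) (auto simp: coord_unit split: if_splits)
  then show ?case by simp
qed

lemma gns_inner_linear:
  "gns_inner \<phi> (x + y) z = gns_inner \<phi> x z + gns_inner \<phi> y z"
  "gns_inner \<phi> z (x + y) = gns_inner \<phi> z x + gns_inner \<phi> z y"
  "gns_inner \<phi> (bscale c x) z = cnj c * gns_inner \<phi> x z"
  "gns_inner \<phi> z (bscale c x) = c * gns_inner \<phi> z x"
  "gns_inner \<phi> 0 z = 0"
  by (simp_all add: gns_inner_def bmult_linear bstar_linear phi_linear)

lemma gns_inner_unit:
  "gns_inner \<phi> (e a i j) (e b k l) = (if a = b \<and> i = k \<and> j = l then of_real (w a j) else 0)"
  by (auto simp: gns_inner_def bstar_unit prod diagonal phi_linear)

lemma gns_inner_eqI: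
  assumes "\<And>z. gns_inner \<phi> x z = gns_inner \<phi> y z"
  shows "x = y"
proof -
  have "coord a i j (bstar x) = coord a i j (bstar y)" for a i j
    using assms by (simp add: coord_def gns_inner_def)
  then have "bstar x = bstar y"
    using coord_expand[of "bstar x"] coord_expand[of "bstar y"] by simp
  then show ?thesis by (metis bstar_bstar)
qed

lemma diagonal_functional_tensor:
  "diagonal_functional (tensor_functional \<phi> \<phi>)
     (\<lambda>p q r. tensor (e (fst p) (fst q) (fst r)) (e (snd p) (snd q) (snd r)))
     (\<lambda>p q. w (fst p) (fst q) * w (snd p) (snd q))"
  by (rule diagonal_functional.intro)
     (auto simp: matrix_units_tensor units tensor_functional_linear weight_pos prod_eq_iff
       tensor_functional_tensor functional diagonal)

text \<open>
  The units are orthogonal for the inner product of \<open>\<phi>\<close>, the squared norm of \<open>e a i j\<close> being \<open>w a j\<close>.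
  So the adjoint can be read off by pairing with the units \<open>e_ir \<otimes> e_rj\<close>, which are the only ones with
  product \<open>e_ij\<close> and have squared norm \<open>w_r w_j\<close>.
\<close>

lemma mult_adjoint_exists:
  obtains M where "blinear M"
    and "\<And>x z. gns_inner (tensor_functional \<phi> \<phi>) (M x) z = gns_inner \<phi> x (mult_map z)"
    and "\<And>a i j. M (e a i j) = (\<Sum>r\<in>UNIV. bscale (of_real (1 / w a r)) (tensor (e a i r) (e a r j)))"
proof -
  interpret T: diagonal_functional "tensor_functional \<phi> \<phi>"
    "\<lambda>p q r. tensor (e (fst p) (fst q) (fst r)) (e (snd p) (snd q) (snd r))"
    "\<lambda>p q. w (fst p) (fst q) * w (snd p) (snd q)"
    by (rule diagonal_functional_tensor)
  define G where "G a i j = (\<Sum>r\<in>UNIV. bscale (of_real (1 / w a r)) (tensor (e a i r) (e a r j)))" for a i j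
  define M where "M x = (\<Sum>p\<in>UNIV. bscale (coord (fst p) (fst (snd p)) (snd (snd p)) x)
     (G (fst p) (fst (snd p)) (snd (snd p))))" for x
  have lin: "blinear M"
    by (simp add: blinear_iff M_def coord_linear blocks.scale_left_distrib sum.distrib
        flip: blocks.scale_scale blocks.scale_sum_right)
  have unit: "M (e a i j) = G a i j" for a i j
  proof -
    have "M (e a i j) = (\<Sum>p\<in>UNIV. if p = (a, i, j) then G a i j else 0)"
      unfolding M_def by (rule sum.cong) (auto simp: coord_unit split: if_splits)
    then show ?thesis by simp
  qed
  have G_inner: "gns_inner (tensor_functional \<phi> \<phi>) (G a i j) z
      = (\<Sum>r\<in>UNIV. of_real (1 / w a r) * gns_inner (tensor_functional \<phi> \<phi>) (tensor (e a i r) (e a r j)) z)"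
    for a i j z
  proof -
    have "gns_inner (tensor_functional \<phi> \<phi>) (\<Sum>r\<in>I. f r) z
      = (\<Sum>r\<in>I. gns_inner (tensor_functional \<phi> \<phi>) (f r) z)" for f :: "'n \<Rightarrow> _" and I
      by (induction I rule: infinite_finite_induct) (simp_all add: T.gns_inner_linear)
    then show ?thesis by (simp add: G_def T.gns_inner_linear)
  qed
  have mult: "mult_map (x + y) = mult_map x + mult_map y" "mult_map (bscale c x) = bscale c (mult_map x)"
    for c and x y :: "('d \<times> 'd, 'n \<times> 'n) blocks"
    using mult_map_linear unfolding blinear_iff by blast+
  have "gns_inner (tensor_functional \<phi> \<phi>) (M x) z = gns_inner \<phi> x (mult_map z)" for x z
  proof (induction x rule: matrix_units_induct[OF units])
    case (3 a i j)
    show ?case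
    proof (induction z rule: matrix_units_induct[OF T.units])
      case (3 p q r)
      have "gns_inner (tensor_functional \<phi> \<phi>) (M (e a i j))
           (tensor (e (fst p) (fst q) (fst r)) (e (snd p) (snd q) (snd r)))
         = (\<Sum>u\<in>UNIV. if a = fst p \<and> i = fst q \<and> a = snd p \<and> j = snd r \<and> fst r = snd q \<and> u = snd q then of_real (w a j) else 0)"
        unfolding unit G_inner
        by (rule sum.cong)
           (use weight_pos in \<open>auto simp: gns_inner_def bstar_tensor bmult_tensor
             tensor_functional_tensor functional bstar_unit prod diagonal phi_linear less_imp_neq[THEN not_sym]\<close>)
      also have "\<dots> = gns_inner \<phi> (e a i j) (mult_map (tensor (e (fst p) (fst q) (fst r)) (e (snd p) (snd q) (snd r))))"
        by (auto simp: mult_map_tensor prod gns_inner_unit) (auto simp: gns_inner_def bmult_linear phi_linear)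
      finally show ?case .
    qed (simp_all add: mult gns_inner_linear T.gns_inner_linear)
  qed (use lin in \<open>simp_all add: blinear_iff gns_inner_linear T.gns_inner_linear\<close>)
  then show ?thesis using that lin unit by (simp add: G_def)
qed

lemma mult_adjoint:
  shows mult_adjoint_linear: "blinear (mult_adjoint \<phi>)"
    and mult_adjoint_unit:
      "mult_adjoint \<phi> (e a i j) = (\<Sum>r\<in>UNIV. bscale (of_real (1 / w a r)) (tensor (e a i r) (e a r j)))"
proof -
  interpret T: diagonal_functional "tensor_functional \<phi> \<phi>"
    "\<lambda>p q r. tensor (e (fst p) (fst q) (fst r)) (e (snd p) (snd q) (snd r))"
    "\<lambda>p q. w (fst p) (fst q) * w (snd p) (snd q)"
    by (rule diagonal_functional_tensor)
  obtain M where M: "blinear M"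
    "\<And>x z. gns_inner (tensor_functional \<phi> \<phi>) (M x) z = gns_inner \<phi> x (mult_map z)"
    "\<And>a i j. M (e a i j) = (\<Sum>r\<in>UNIV. bscale (of_real (1 / w a r)) (tensor (e a i r) (e a r j)))"
    using mult_adjoint_exists by blast
  have "mult_adjoint \<phi> = M"
    unfolding mult_adjoint_def
  proof (rule the_equality)
    fix N assume N: "blinear N \<and> (\<forall>x z. gns_inner (tensor_functional \<phi> \<phi>) (N x) z = gns_inner \<phi> x (mult_map z))"
    show "N = M" by (rule ext, rule T.gns_inner_eqI) (simp add: N M)
  qed (simp add: M)
  then show "blinear (mult_adjoint \<phi>)"
    "mult_adjoint \<phi> (e a i j) = (\<Sum>r\<in>UNIV. bscale (of_real (1 / w a r)) (tensor (e a i r) (e a r j)))"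
    using M by simp_all
qed

end

section \<open>Linear maps into a C*-algebra\<close>

context unital_cstar_algebra
begin

lemma linear_into_mu_tensor:
  assumes S: "linear_into A S" and T: "linear_into A T"
  shows "linear_into A (mu_tensor A S T)"
proof -
  have c [simp]: "S x \<in> carrier A" "T y \<in> carrier A" for x y
    using S T by (simp_all add: linear_into_def)
  have [simp]: "(\<lambda>x. finsum A (f x) I) \<in> J \<rightarrow> carrier A" if "\<And>x y. f x y \<in> carrier A" for f I J
    using that by auto
  show ?thesis
    unfolding linear_into_def mu_tensor_def case_prod_unfold
    by (simp add: bscale_def scale_closed scale_add_left finsum_addf scale_finsum scale_scale Pi_def
        flip: scale_scale)
qed

lemma linear_into_map_star: "linear_into A S \<Longrightarrow> linear_into A (map_star A S)"
  by (simp add: linear_into_def map_star_def bstar_linear star_closed star_add star_scale)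

lemma linear_into_comp: "linear_into A F \<Longrightarrow> blinear G \<Longrightarrow> linear_into A (\<lambda>x. F (G x))"
  by (simp add: linear_into_def blinear_iff)

lemma linear_into_scale: "linear_into A F \<Longrightarrow> linear_into A (\<lambda>x. scale A c (F x))"
  by (simp add: linear_into_def scale_closed scale_add_right scale_scale mult.commute)

lemma linear_into_zero: "linear_into A F \<Longrightarrow> F 0 = \<zero>"
  using linear_into_sum[OF unital_cstar_algebra_axioms, of F "{}"] by simp

lemma linear_into_eq_iff:
  assumes e: "matrix_units e" and F: "linear_into A F" and G: "linear_into A G"
  shows "(\<forall>x. F x = G x) \<longleftrightarrow> (\<forall>a i j. F (e a i j) = G (e a i j))"
proof (intro iffI allI)
  fix x assume "\<forall>a i j. F (e a i j) = G (e a i j)"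
  then show "F x = G x"
    using F G by (induction x rule: matrix_units_induct[OF e]) (simp_all add: linear_into_def)
qed simp

end

lemma (in diagonal_functional) linear_into_exists:
  assumes C: "unital_cstar_algebra C" and \<sigma>: "\<And>a i j. \<sigma> a i j \<in> carrier C"
  obtains S where "linear_into C S" "\<And>a i j. S (e a i j) = \<sigma> a i j"
proof -
  interpret C: unital_cstar_algebra C by fact
  define S where "S x = (\<Oplus>\<^bsub>C\<^esub>p\<in>UNIV. scale C (coord (fst p) (fst (snd p)) (snd (snd p)) x)
     (\<sigma> (fst p) (fst (snd p)) (snd (snd p))))" for x
  have c [simp]: "scale C c (\<sigma> a i j) \<in> carrier C" for c a i j by (simp add: \<sigma> C.scale_closed)
  have "linear_into C S"
    unfolding linear_into_def S_def
    by (simp add: coord_linear C.scale_add_left \<sigma> C.finsum_addf C.scale_finsum Pi_def flip: C.scale_scale)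
  moreover have "S (e a i j) = \<sigma> a i j" for a i j
  proof -
    have "S (e a i j) = (\<Oplus>\<^bsub>C\<^esub>p\<in>UNIV. if p = (a, i, j) then \<sigma> a i j else \<zero>\<^bsub>C\<^esub>)"
      unfolding S_def
      by (rule C.finsum_cong')
         (auto simp: coord_unit C.scale_one C.scale_zero_left \<sigma> split: if_splits)
    then show ?thesis by (simp add: C.finsum_delta \<sigma>)
  qed
  ultimately show ?thesis using that by blast
qed

section \<open>Families for the dephasing graph\<close>

text \<open>
  The axioms (LQCK1), (LQCK2) and (LQCK3) for the dephasing graph in terms of rescaled matrix units, with
  all scalars removed.
\<close>

definition dephasing_relations ::
  "('u, 'r) cstar_scheme \<Rightarrow> ('d::finite \<Rightarrow> 'n::finite \<Rightarrow> 'n \<Rightarrow> 'u) \<Rightarrow> bool" where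
  "dephasing_relations C t \<longleftrightarrow>
     (\<forall>a i j. t a i j \<in> carrier C) \<and>
     (\<forall>a i j b k l. (\<Oplus>\<^bsub>C\<^esub>r\<in>UNIV. t a i r \<otimes>\<^bsub>C\<^esub> star C (t a j r)) \<otimes>\<^bsub>C\<^esub> t b k l =
        (if a = b \<and> j = k then t a i l else \<zero>\<^bsub>C\<^esub>)) \<and>
     (\<forall>a i j b k l. star C (t a j i) \<otimes>\<^bsub>C\<^esub> t b k l =
        (if a = b \<and> j = k \<and> i = l then \<Oplus>\<^bsub>C\<^esub>r\<in>UNIV. t a i r \<otimes>\<^bsub>C\<^esub> star C (t a i r) else \<zero>\<^bsub>C\<^esub>)) \<and>
     (\<Oplus>\<^bsub>C\<^esub>a\<in>UNIV. \<Oplus>\<^bsub>C\<^esub>i\<in>UNIV. \<Oplus>\<^bsub>C\<^esub>r\<in>UNIV. t a i r \<otimes>\<^bsub>C\<^esub> star C (t a i r)) = \<one>\<^bsub>C\<^esub>"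

locale dephasing = diagonal_functional \<psi> e w
  for \<psi> :: "('d::finite, 'n::finite) blocks \<Rightarrow> complex" and e w +
  fixes D :: "('d, 'n) blocks \<Rightarrow> ('d, 'n) blocks" and \<delta> :: real
  assumes delta_pos: "\<delta> > 0"
    and D_linear: "blinear D"
    and D_unit: "D (e a i j) = (if i = j then bscale (of_real (w a i * \<delta>\<^sup>2)) (e a i i) else 0)"
begin

text \<open>
  Both sides of (LQCK1) and (LQCK2) are linear, so they agree if they agree on the matrix units of the
  tensor square, and in (LQCK3) the unit of B is the sum of the \<open>e a i i\<close>. On matrix units the factor \<open>w_r\<inverse>\<close> of the adjoint is absorbed by the
  normalisation of the two elements \<open>t_ir\<close> and \<open>t_jr\<close>, up to the common factor \<open>\<delta>^(-2)\<close>, and the factor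
  \<open>w_i \<delta>\<^sup>2\<close> from the dephasing graph cancels against the normalisation on the left of (LQCK2).
\<close>

lemma lqck_family_iff:
  fixes C :: "('u, 'r) cstar_scheme"
  assumes C: "unital_cstar_algebra C" and S: "linear_into C S"
    and t_def: "\<And>a i j. t a i j = scale C (of_real (\<delta> / sqrt (w a j))) (S (e a i j))"
  shows "lqck_family \<delta> \<psi> D C S \<longleftrightarrow> dephasing_relations C t"
proof -
  interpret C: unital_cstar_algebra C by fact
  interpret T: diagonal_functional "tensor_functional \<psi> \<psi>"
    "\<lambda>p q r. tensor (e (fst p) (fst q) (fst r)) (e (snd p) (snd q) (snd r))"
    "\<lambda>p q. w (fst p) (fst q) * w (snd p) (snd q)"
    by (rule diagonal_functional_tensor)
  define Q where "Q a i j = (\<Oplus>\<^bsub>C\<^esub>r\<in>UNIV. t a i r \<otimes>\<^bsub>C\<^esub> star C (t a j r))" for a i j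
  define d where "d = complex_of_real (inverse (\<delta>\<^sup>2))"
  define \<gamma> where "\<gamma> a j = complex_of_real (sqrt (w a j) / \<delta>)" for a j
  have Sc [simp]: "S x \<in> carrier C" for x using S by (simp add: linear_into_def)
  have tc [simp]: "t a i j \<in> carrier C" for a i j by (simp add: t_def C.scale_closed)
  have Qc [simp]: "Q a i j \<in> carrier C" for a i j by (auto simp: Q_def C.star_closed intro!: C.finsum_closed)
  have w: "sqrt (w a j) > 0" "sqrt (w a j) * sqrt (w a j) = w a j" for a j
    using weight_pos[of a j] by simp_all
  have d0: "d \<noteq> 0" and \<gamma>0: "\<gamma> a j \<noteq> 0" and cnj_\<gamma>: "cnj (\<gamma> a j) = \<gamma> a j" for a j
    using delta_pos w[of a j] by (simp_all add: d_def \<gamma>_def)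
  have \<gamma>\<gamma>: "\<gamma> a j * \<gamma> a j = of_real (w a j) * d" for a j
    using delta_pos w(2)[of a j]
    by (simp add: d_def \<gamma>_def power2_eq_square field_simps flip: of_real_mult)
  have \<gamma>_inverse: "\<gamma> a j * of_real (\<delta> / sqrt (w a j)) = 1" for a j
    unfolding \<gamma>_def of_real_mult[symmetric] using delta_pos w(1)[of a j] by simp
  have S_unit: "S (e a i j) = scale C (\<gamma> a j) (t a i j)" for a i j
    by (simp only: t_def C.scale_scale[OF Sc] \<gamma>_inverse C.scale_one[OF Sc])
  have star_S: "map_star C S (e a i j) = star C (S (e a j i))" for a i j
    by (simp add: map_star_def bstar_unit)
  let ?\<mu> = "mu_tensor C S (map_star C S)"
  note lin_star = C.linear_into_map_star[OF S]
  note lin_\<mu> = C.linear_into_mu_tensor[OF S lin_star]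
  have \<mu>_adjoint: "?\<mu> (mult_adjoint \<psi> (e a i j)) = scale C d (Q a i j)" for a i j
  proof -
    have "?\<mu> (mult_adjoint \<psi> (e a i j))
        = (\<Oplus>\<^bsub>C\<^esub>r\<in>UNIV. ?\<mu> (bscale (of_real (1 / w a r)) (tensor (e a i r) (e a r j))))"
      by (simp add: mult_adjoint_unit linear_into_sum[OF C lin_\<mu>])
    also have "\<dots> = (\<Oplus>\<^bsub>C\<^esub>r\<in>UNIV. scale C d (t a i r \<otimes>\<^bsub>C\<^esub> star C (t a j r)))"
    proof (rule C.finsum_cong')
      fix r
      have "?\<mu> (bscale (of_real (1 / w a r)) (tensor (e a i r) (e a r j)))
          = scale C (of_real (1 / w a r)) (S (e a i r) \<otimes>\<^bsub>C\<^esub> star C (S (e a j r)))"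
        using lin_\<mu> by (simp add: linear_into_def mu_tensor_tensor[OF C S lin_star] star_S)
      also have "\<dots> = scale C (of_real (1 / w a r) * (\<gamma> a r * \<gamma> a r)) (t a i r \<otimes>\<^bsub>C\<^esub> star C (t a j r))"
        by (simp add: S_unit C.star_scale cnj_\<gamma> C.scale_mult_left C.scale_mult_right C.scale_closed
            C.star_closed C.scale_scale mult_ac)
      also have "of_real (1 / w a r) * (\<gamma> a r * \<gamma> a r) = d"
        using weight_pos[of a r] by (simp add: \<gamma>\<gamma>)
      finally show "?\<mu> (bscale (of_real (1 / w a r)) (tensor (e a i r) (e a r j)))
          = scale C d (t a i r \<otimes>\<^bsub>C\<^esub> star C (t a j r))" .
    qed (simp_all add: C.scale_closed C.star_closed)
    also have "\<dots> = scale C d (Q a i j)"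
      by (simp add: Q_def C.scale_finsum C.star_closed)
    finally show ?thesis .
  qed
  have L1: "(\<forall>z. mu_tensor C ?\<mu> S (tensor_map (mult_adjoint \<psi>) id z) = scale C d (S (mult_map z)))
     \<longleftrightarrow> (\<forall>a i j b k l. Q a i j \<otimes>\<^bsub>C\<^esub> t b k l = (if a = b \<and> j = k then t a i l else \<zero>\<^bsub>C\<^esub>))"
  proof -
    have id: "blinear (id :: ('d, 'n) blocks \<Rightarrow> ('d, 'n) blocks)" by (simp add: blinear_iff)
    have "(\<forall>z. mu_tensor C ?\<mu> S (tensor_map (mult_adjoint \<psi>) id z) = scale C d (S (mult_map z)))
      \<longleftrightarrow> (\<forall>a b i k j l. mu_tensor C ?\<mu> S (tensor_map (mult_adjoint \<psi>) id (tensor (e a i j) (e b k l)))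
         = scale C d (S (mult_map (tensor (e a i j) (e b k l)))))"
      by (subst C.linear_into_eq_iff[OF T.units])
         (simp_all add: C.linear_into_comp C.linear_into_mu_tensor C.linear_into_scale lin_\<mu> S
            tensor_map_linear mult_map_linear)
    also have "\<dots> \<longleftrightarrow> (\<forall>a b i k j l. Q a i j \<otimes>\<^bsub>C\<^esub> t b k l = (if a = b \<and> j = k then t a i l else \<zero>\<^bsub>C\<^esub>))"
    proof (intro iff_allI)
      fix a b i k j l
      have 1: "mu_tensor C ?\<mu> S (tensor_map (mult_adjoint \<psi>) id (tensor (e a i j) (e b k l)))
         = scale C (d * \<gamma> b l) (Q a i j \<otimes>\<^bsub>C\<^esub> t b k l)"
        by (simp add: tensor_map_tensor[OF mult_adjoint_linear id] mu_tensor_tensor[OF C lin_\<mu> S]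
            \<mu>_adjoint S_unit C.scale_mult_left C.scale_mult_right C.scale_closed C.scale_scale mult.commute)
      have 2: "scale C d (S (mult_map (tensor (e a i j) (e b k l))))
         = scale C (d * \<gamma> b l) (if a = b \<and> j = k then t a i l else \<zero>\<^bsub>C\<^esub>)"
        using S by (auto simp: mult_map_tensor prod S_unit C.scale_scale C.scale_zero C.linear_into_zero)
      show "(mu_tensor C ?\<mu> S (tensor_map (mult_adjoint \<psi>) id (tensor (e a i j) (e b k l)))
           = scale C d (S (mult_map (tensor (e a i j) (e b k l)))))
        = (Q a i j \<otimes>\<^bsub>C\<^esub> t b k l = (if a = b \<and> j = k then t a i l else \<zero>\<^bsub>C\<^esub>))"
        unfolding 1 2 by (rule C.scale_cancel) (auto simp: d0 \<gamma>0)
    qed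
    finally show ?thesis by blast
  qed
  have L2: "(\<forall>z. mu_tensor C (map_star C S) S z = scale C d (?\<mu> (mult_adjoint \<psi> (D (mult_map z)))))
     \<longleftrightarrow> (\<forall>a i j b k l. star C (t a j i) \<otimes>\<^bsub>C\<^esub> t b k l = (if a = b \<and> j = k \<and> i = l then Q a i i else \<zero>\<^bsub>C\<^esub>))"
  proof -
    have "(\<forall>z. mu_tensor C (map_star C S) S z = scale C d (?\<mu> (mult_adjoint \<psi> (D (mult_map z)))))
      \<longleftrightarrow> (\<forall>a b i k j l. mu_tensor C (map_star C S) S (tensor (e a i j) (e b k l))
         = scale C d (?\<mu> (mult_adjoint \<psi> (D (mult_map (tensor (e a i j) (e b k l)))))))"
      by (subst C.linear_into_eq_iff[OF T.units])
         (simp_all add: C.linear_into_mu_tensor lin_star S C.linear_into_scale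
            C.linear_into_comp[OF C.linear_into_comp[OF C.linear_into_comp[OF lin_\<mu> mult_adjoint_linear] D_linear]
              mult_map_linear])
    also have "\<dots> \<longleftrightarrow> (\<forall>a b i k j l. star C (t a j i) \<otimes>\<^bsub>C\<^esub> t b k l = (if a = b \<and> j = k \<and> i = l then Q a i i else \<zero>\<^bsub>C\<^esub>))"
    proof (intro iff_allI)
      fix a b i k j l
      have lin: "linear_into C (\<lambda>x. ?\<mu> (mult_adjoint \<psi> x))"
        by (rule C.linear_into_comp[OF lin_\<mu> mult_adjoint_linear])
      have 1: "mu_tensor C (map_star C S) S (tensor (e a i j) (e b k l))
         = scale C (\<gamma> a i * \<gamma> b l) (star C (t a j i) \<otimes>\<^bsub>C\<^esub> t b k l)"
        by (simp add: mu_tensor_tensor[OF C lin_star S] star_S S_unit C.star_scale cnj_\<gamma>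
            C.star_closed C.scale_mult_left C.scale_mult_right C.scale_closed C.scale_scale mult_ac)
      have D0: "D 0 = 0" using D_linear unfolding blinear_iff by (metis blocks.scale_zero_left)
      have 3: "?\<mu> (mult_adjoint \<psi> (bscale c x)) = scale C c (?\<mu> (mult_adjoint \<psi> x))" for c x
        using lin by (simp add: linear_into_def)
      have dd: "d * (of_real (w a i * \<delta>\<^sup>2) * d) = \<gamma> a i * \<gamma> a i" for a i
        using delta_pos by (simp add: \<gamma>\<gamma> d_def)
      have 2: "scale C d (?\<mu> (mult_adjoint \<psi> (D (mult_map (tensor (e a i j) (e b k l))))))
         = scale C (\<gamma> a i * \<gamma> b l) (if a = b \<and> j = k \<and> i = l then Q a i i else \<zero>\<^bsub>C\<^esub>)"
        using C.linear_into_zero[OF lin]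
        by (auto simp: mult_map_tensor prod D_unit D0 C.scale_zero 3 \<mu>_adjoint C.scale_scale dd
            simp del: of_real_mult)
      show "(mu_tensor C (map_star C S) S (tensor (e a i j) (e b k l))
         = scale C d (?\<mu> (mult_adjoint \<psi> (D (mult_map (tensor (e a i j) (e b k l)))))))
        = (star C (t a j i) \<otimes>\<^bsub>C\<^esub> t b k l = (if a = b \<and> j = k \<and> i = l then Q a i i else \<zero>\<^bsub>C\<^esub>))"
        unfolding 1 2 by (rule C.scale_cancel) (auto simp: \<gamma>0 C.star_closed)
    qed
    finally show ?thesis by blast
  qed
  have L3: "?\<mu> (mult_adjoint \<psi> bone) = scale C d \<one>\<^bsub>C\<^esub>
    \<longleftrightarrow> (\<Oplus>\<^bsub>C\<^esub>a\<in>UNIV. \<Oplus>\<^bsub>C\<^esub>i\<in>UNIV. Q a i i) = \<one>\<^bsub>C\<^esub>"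
  proof -
    have lin: "linear_into C (\<lambda>x. ?\<mu> (mult_adjoint \<psi> x))"
      by (rule C.linear_into_comp[OF lin_\<mu> mult_adjoint_linear])
    have one: "bone = (\<Sum>a\<in>UNIV. \<Sum>i\<in>UNIV. e a i i)"
      using units by (simp add: matrix_units_def)
    have "?\<mu> (mult_adjoint \<psi> bone) = (\<Oplus>\<^bsub>C\<^esub>a\<in>UNIV. \<Oplus>\<^bsub>C\<^esub>i\<in>UNIV. scale C d (Q a i i))"
      unfolding one by (simp add: linear_into_sum[OF C lin] \<mu>_adjoint)
    also have "\<dots> = scale C d (\<Oplus>\<^bsub>C\<^esub>a\<in>UNIV. \<Oplus>\<^bsub>C\<^esub>i\<in>UNIV. Q a i i)"
      by (simp add: C.scale_finsum)
    finally show ?thesis by (simp add: C.scale_cancel d0)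
  qed
  show ?thesis
    unfolding lqck_family_def dephasing_relations_def d_def[symmetric] L1 L2 L3 Q_def[symmetric]
    using C S by simp
qed

end

context unital_cstar_algebra
begin

lemma finsum_zero_fun: "(\<Oplus>i\<in>I. \<zero>) = \<zero>"
  by (rule add.finprod_one_eqI) simp

lemma finsum_if: "(\<And>i. i \<in> I \<Longrightarrow> f i \<in> carrier A) \<Longrightarrow>
    (\<Oplus>i\<in>I. if P then f i else \<zero>) = (if P then (\<Oplus>i\<in>I. f i) else \<zero>)"
  by (simp add: finsum_zero_fun)

lemma finsum_delta2:
  assumes "x \<in> carrier A"
  shows "(\<Oplus>a\<in>UNIV. \<Oplus>j\<in>UNIV. if a = (b :: 'a :: finite) \<and> j = (k :: 'b :: finite) then x else \<zero>) = x"
proof -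
  have "(\<Oplus>j\<in>UNIV. if a = b \<and> j = k then x else \<zero>) = (if a = b then x else \<zero>)" for a
    using finsum_delta[of UNIV k x] assms by (cases "a = b") (simp_all add: finsum_zero_fun)
  then show ?thesis using finsum_delta[of UNIV b x] assms by simp
qed

lemma finsum_exchange:
  assumes "finite I" "finite J" "\<And>i j. i \<in> I \<Longrightarrow> j \<in> J \<Longrightarrow> f i j \<in> carrier A"
  shows "(\<Oplus>i\<in>I. \<Oplus>j\<in>J. f i j) = (\<Oplus>j\<in>J. \<Oplus>i\<in>I. f i j)"
  using assms(1,3)
proof (induction I rule: finite_induct)
  case empty
  then show ?case by (simp add: finsum_zero_fun)
next
  case (insert i I)
  have "(\<Oplus>j\<in>J. \<Oplus>i\<in>insert i I. f i j) = (\<Oplus>j\<in>J. f i j \<oplus> (\<Oplus>i\<in>I. f i j))"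
    using insert by (intro finsum_cong') (auto intro!: finsum_closed)
  also have "\<dots> = (\<Oplus>j\<in>J. f i j) \<oplus> (\<Oplus>j\<in>J. \<Oplus>i\<in>I. f i j)"
    using insert.prems by (intro finsum_addf) (auto intro!: finsum_closed)
  finally show ?case
    using insert by (subst finsum_insert) (auto intro!: finsum_closed)
qed

text \<open>
  The relations give \<open>t_ij P_j = t_ij\<close>, where \<open>P_j\<close> is the source projection of \<open>t_ij\<close>, and the \<open>P_j\<close> of all
  blocks are orthogonal. So \<open>t a i j\<close> annihilates the adjoint of \<open>t b k l\<close> unless \<open>a = b\<close> and \<open>j = l\<close>,
  just as the adjoint of \<open>t a i j\<close> annihilates \<open>t b k l\<close> from the left unless all indices agree. Only the
  diagonal terms of \<open>V_i* V_i\<close> and \<open>V_i V_i*\<close> survive.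
\<close>

lemma dephasing_relations_cuntz:
  fixes t :: "'d::finite \<Rightarrow> 'n::finite \<Rightarrow> 'n \<Rightarrow> 'u"
  assumes "dephasing_relations A t"
  shows "cuntz_isometries A (\<lambda>i. \<Oplus>a\<in>UNIV. \<Oplus>j\<in>UNIV. t a i j)"
proof -
  define P where "P a i = (\<Oplus>r\<in>UNIV. t a i r \<otimes> star A (t a i r))" for a i
  have t [simp]: "t a i j \<in> carrier A" "star A (t a i j) \<in> carrier A" for a i j
    using assms by (simp_all add: dephasing_relations_def star_closed)
  have P [simp]: "P a i \<in> carrier A" for a i by (auto simp: P_def intro!: finsum_closed)
  have Pt: "P a i \<otimes> t b k l = (if a = b \<and> i = k then t a i l else \<zero>)" for a i b k l
    using assms by (simp add: dephasing_relations_def P_def)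
  have tt: "star A (t a i j) \<otimes> t b k l = (if a = b \<and> i = k \<and> j = l then P a j else \<zero>)" for a i j b k l
    using assms by (simp add: dephasing_relations_def P_def)
  have one: "(\<Oplus>a\<in>UNIV. \<Oplus>i\<in>UNIV. P a i) = \<one>"
    using assms by (simp add: dephasing_relations_def P_def)
  have PP: "P a i \<otimes> P b k = \<zero>" if "(a, i) \<noteq> (b, k)" for a i b k
  proof -
    have "P a i \<otimes> P b k = (\<Oplus>r\<in>UNIV. P a i \<otimes> t b k r \<otimes> star A (t b k r))"
      unfolding P_def[of b k] by (simp add: finsum_rdistr m_assoc Pi_def)
    moreover have "P a i \<otimes> t b k r = \<zero>" for r using that by (auto simp: Pt)
    ultimately show ?thesis by (simp add: finsum_zero_fun)
  qed
  have tP: "t a i j \<otimes> P a j = t a i j" for a i j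
  proof -
    have "P a i \<otimes> t a i j = (\<Oplus>r\<in>UNIV. t a i r \<otimes> (star A (t a i r) \<otimes> t a i j))"
      unfolding P_def by (simp add: finsum_ldistr m_assoc Pi_def)
    also have "\<dots> = (\<Oplus>r\<in>UNIV. if r = j then t a i j \<otimes> P a j else \<zero>)"
      by (rule finsum_cong') (auto simp: tt)
    also have "\<dots> = t a i j \<otimes> P a j" by (simp add: finsum_delta)
    finally show ?thesis by (simp add: Pt)
  qed
  have ts: "t a i j \<otimes> star A (t b k l) = \<zero>" if "(a, j) \<noteq> (b, l)" for a i j b k l
  proof -
    have "star A (P b l) = P b l"
      using tt[of b k l b k l] star_mult[of "star A (t b k l)" "t b k l"] by (simp add: star_star)
    then have "star A (t b k l) = P b l \<otimes> star A (t b k l)"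
      using star_mult[of "t b k l" "P b l"] by (simp add: tP)
    then have "t a i j \<otimes> star A (t b k l) = t a i j \<otimes> (P a j \<otimes> P b l) \<otimes> star A (t b k l)"
      using tP[of a i j] by (simp add: m_assoc flip: m_assoc[of "t a i j" "P a j"])
    then show ?thesis using PP[OF that] by simp
  qed
  define V where "V i = (\<Oplus>a\<in>UNIV. \<Oplus>j\<in>UNIV. t a i j)" for i
  have V [simp]: "V i \<in> carrier A" "star A (V i) \<in> carrier A" for i
    by (auto simp: V_def intro!: star_closed finsum_closed)
  have V_star: "star A (V i) = (\<Oplus>a\<in>UNIV. \<Oplus>j\<in>UNIV. star A (t a i j))" for i
    by (simp add: V_def star_finsum finsum_closed Pi_def)
  have tV: "star A (t a i j) \<otimes> V i = P a j" for a i j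
  proof -
    have "star A (t a i j) \<otimes> V i = (\<Oplus>b\<in>UNIV. \<Oplus>l\<in>UNIV. star A (t a i j) \<otimes> t b i l)"
      by (simp add: V_def finsum_rdistr finsum_closed Pi_def)
    also have "\<dots> = (\<Oplus>b\<in>UNIV. \<Oplus>l\<in>UNIV. if b = a \<and> l = j then P a j else \<zero>)"
      by (simp add: tt eq_commute)
    finally show ?thesis by (simp add: finsum_delta2)
  qed
  have tVs: "t a i j \<otimes> star A (V i) = t a i j \<otimes> star A (t a i j)" for a i j
  proof -
    have "t a i j \<otimes> star A (V i) = (\<Oplus>b\<in>UNIV. \<Oplus>l\<in>UNIV. t a i j \<otimes> star A (t b i l))"
      by (simp add: V_star finsum_rdistr finsum_closed Pi_def)
    also have "\<dots> = (\<Oplus>b\<in>UNIV. \<Oplus>l\<in>UNIV. if b = a \<and> l = j then t a i j \<otimes> star A (t a i j) else \<zero>)"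
      by (intro finsum_cong' refl) (auto simp: ts intro!: finsum_closed)
    finally show ?thesis by (simp add: finsum_delta2)
  qed
  have "star A (V i) \<otimes> V i = \<one>" for i
  proof -
    have "star A (V i) \<otimes> V i = (\<Oplus>a\<in>UNIV. \<Oplus>j\<in>UNIV. star A (t a i j) \<otimes> V i)"
      unfolding V_star by (simp add: finsum_ldistr finsum_closed Pi_def)
    then show ?thesis by (simp add: tV one)
  qed
  moreover have "(\<Oplus>i\<in>UNIV. V i \<otimes> star A (V i)) = \<one>"
  proof -
    have "V i \<otimes> star A (V i) = (\<Oplus>a\<in>UNIV. P a i)" for i
    proof -
      have "V i \<otimes> star A (V i) = (\<Oplus>a\<in>UNIV. \<Oplus>j\<in>UNIV. t a i j \<otimes> star A (V i))"
        unfolding V_def[of i] using V(2)[of i, unfolded V_def[of i]] by (simp add: finsum_ldistr finsum_closed Pi_def)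
      then show ?thesis by (simp add: tVs P_def)
    qed
    then show ?thesis using finsum_exchange[of UNIV UNIV "\<lambda>i a. P a i"] one by simp
  qed
  ultimately show ?thesis by (simp add: cuntz_isometries_def flip: V_def)
qed

text \<open>
  With \<open>t a0 i j = v_i p_j\<close> for the range projections \<open>p_j\<close>, one has \<open>P_i = v_i (\<Sum>_r p_r) v_i* = p_i\<close> in the
  block \<open>a0\<close>. Putting everything into one block is consistent: a block on which \<open>t\<close> vanishes satisfies
  all relations but the last one trivially, and it contributes nothing to the last one.
\<close>

lemma cuntz_dephasing_relations:
  fixes v :: "'n::finite \<Rightarrow> 'u" and a0 :: "'d::finite"
  assumes v: "cuntz_isometries A v"
    and t_def: "t = (\<lambda>a i j. if a = a0 then v i \<otimes> (v j \<otimes> star A (v j)) else \<zero>)"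
  shows "dephasing_relations A t" and "(\<Oplus>a\<in>UNIV. \<Oplus>j\<in>UNIV. t a i j) = v i"
proof -
  have vc [simp]: "v k \<in> carrier A" "star A (v k) \<in> carrier A" for k
    using v by (simp_all add: cuntz_isometries_def star_closed)
  define p where "p k = v k \<otimes> star A (v k)" for k
  have p [simp]: "p k \<in> carrier A" for k by (simp add: p_def)
  have sum_p: "(\<Oplus>k\<in>UNIV. p k) = \<one>" using v by (simp add: cuntz_isometries_def p_def)
  have vv: "star A (v i) \<otimes> v j = (if i = j then \<one> else \<zero>)" for i j
    by (rule cuntz_isometries_orthogonal[OF v])
  have pv: "p i \<otimes> v j = (if i = j then v j else \<zero>)" for i j
    by (auto simp: p_def m_assoc vv)
  have vp: "star A (v i) \<otimes> p j = (if i = j then star A (v i) else \<zero>)" for i j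
    by (auto simp: p_def vv simp flip: m_assoc)
  have pp: "p i \<otimes> p j = (if i = j then p i else \<zero>)" for i j
  proof -
    have "p i \<otimes> p j = v i \<otimes> (star A (v i) \<otimes> p j)" by (subst p_def) (simp add: m_assoc)
    then show ?thesis unfolding vp by (cases "i = j") (simp_all flip: p_def)
  qed
  have p_star: "star A (p i) = p i" for i by (simp add: p_def star_mult star_star)
  have t: "t a i j = (if a = a0 then v i \<otimes> p j else \<zero>)" for a i j by (simp add: t_def p_def)
  have tc [simp]: "t a i j \<in> carrier A" "star A (t a i j) \<in> carrier A" for a i j
    by (simp_all add: t star_closed)
  have t_star: "star A (t a i j) = (if a = a0 then p j \<otimes> star A (v i) else \<zero>)" for a i j
    by (simp add: t star_mult p_star star_zero)
  have Q: "(\<Oplus>r\<in>UNIV. t a i r \<otimes> star A (t a j r)) = (if a = a0 then v i \<otimes> star A (v j) else \<zero>)" for a i j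
  proof (cases "a = a0")
    case True
    have "t a i r \<otimes> star A (t a j r) = v i \<otimes> (p r \<otimes> p r) \<otimes> star A (v j)" for r
      unfolding t using True by (simp add: m_assoc star_mult p_star)
    then have "(\<Oplus>r\<in>UNIV. t a i r \<otimes> star A (t a j r)) = (\<Oplus>r\<in>UNIV. v i \<otimes> p r \<otimes> star A (v j))"
      by (simp add: pp)
    also have "\<dots> = v i \<otimes> (\<Oplus>r\<in>UNIV. p r) \<otimes> star A (v j)"
      by (simp add: finsum_ldistr finsum_rdistr Pi_def)
    finally show ?thesis using True by (simp add: sum_p)
  qed (simp add: t finsum_zero_fun star_zero)
  have 1: "(if a = a0 then v i \<otimes> star A (v j) else \<zero>) \<otimes> t b k l
      = (if a = b \<and> j = k then t a i l else \<zero>)" for a i j b k l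
  proof -
    have "v i \<otimes> star A (v j) \<otimes> (v k \<otimes> p l) = v i \<otimes> (star A (v j) \<otimes> v k) \<otimes> p l"
      for i j k l by (simp add: m_assoc)
    then have "v i \<otimes> star A (v j) \<otimes> (v k \<otimes> p l) = (if j = k then v i \<otimes> p l else \<zero>)" for i j k l
      by (simp add: vv)
    then show ?thesis by (auto simp: t)
  qed
  have 2: "star A (t a j i) \<otimes> t b k l
      = (if a = b \<and> j = k \<and> i = l then if a = a0 then v i \<otimes> star A (v i) else \<zero> else \<zero>)" for a i j b k l
  proof -
    have "p i \<otimes> star A (v j) \<otimes> (v k \<otimes> p l) = p i \<otimes> (star A (v j) \<otimes> v k) \<otimes> p l"
      for i j k l by (simp add: m_assoc)
    then have "p i \<otimes> star A (v j) \<otimes> (v k \<otimes> p l) = (if j = k \<and> i = l then p i else \<zero>)" for i j k l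
      by (simp add: vv pp)
    then show ?thesis unfolding t_star unfolding t by (auto simp flip: p_def)
  qed
  have 3: "(\<Oplus>a\<in>UNIV. \<Oplus>i\<in>UNIV. if a = a0 then v i \<otimes> star A (v i) else \<zero>) = \<one>"
    by (simp add: finsum_if finsum_delta sum_p flip: p_def)
  show "dephasing_relations A t"
    unfolding dephasing_relations_def Q using 1 2 3 by simp
  have "(\<Oplus>j\<in>UNIV. v i \<otimes> p j) = v i \<otimes> (\<Oplus>j\<in>UNIV. p j)"
    by (simp add: finsum_rdistr)
  then show "(\<Oplus>a\<in>UNIV. \<Oplus>j\<in>UNIV. t a i j) = v i"
    by (simp add: t finsum_if finsum_delta sum_p)
qed

text \<open>
  The last relation writes the unit as a polynomial in the elements of \<open>t\<close> and their adjoints, so the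
  C*-algebra that they generate contains it.
\<close>

lemma dephasing_relations_subalgebra:
  assumes t: "dephasing_relations A t" and H: "cstar_subalgebra A H"
    and tH: "\<And>a i j. t a i j \<in> H"
  shows "\<one> \<in> H" and "dephasing_relations (A\<lparr>carrier := H\<rparr>) t"
proof -
  have sub: "H \<subseteq> carrier A" using H by (simp add: cstar_subalgebra_def)
  have cl: "x \<otimes> star A y \<in> H" if "x \<in> H" "y \<in> H" for x y
    using H that by (simp add: cstar_subalgebra_def)
  have sum: "finsum A f I \<in> H" if "finite I" "\<And>i. f i \<in> H" for f and I :: "'i set"
    using that(1)
  proof (induction I rule: finite_induct)
    case empty then show ?case using H by (simp add: cstar_subalgebra_def)
  next
    case (insert i I)
    then have "finsum A f (insert i I) = f i \<oplus> finsum A f I"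
      using that(2) sub by (intro finsum_insert) auto
    then show ?case using insert H that(2) by (simp add: cstar_subalgebra_def)
  qed
  have Q: "(\<Oplus>r\<in>UNIV. t a i r \<otimes> star A (t a j r)) \<in> H" for a i j
    by (rule sum[OF finite]) (intro cl tH)
  have QQ: "(\<Oplus>i\<in>UNIV. \<Oplus>r\<in>UNIV. t a i r \<otimes> star A (t a i r)) \<in> H" for a
    by (rule sum[OF finite Q])
  have "(\<Oplus>a\<in>UNIV. \<Oplus>i\<in>UNIV. \<Oplus>r\<in>UNIV. t a i r \<otimes> star A (t a i r)) \<in> H"
    by (rule sum[OF finite QQ])
  then show one: "\<one> \<in> H" using t by (simp add: dephasing_relations_def)
  have B: "unital_cstar_algebra (A\<lparr>carrier := H\<rparr>)"
    by (rule unital_cstar_subalgebra[OF unital_cstar_algebra_axioms H one])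
  have eq: "finsum (A\<lparr>carrier := H\<rparr>) f UNIV = finsum A f UNIV" if "\<And>i. f i \<in> H"
    for f :: "'i::finite \<Rightarrow> 'u"
    by (rule finsum_subalgebra[OF B sub finite that])
  have 1: "finsum (A\<lparr>carrier := H\<rparr>) (\<lambda>r. t a i r \<otimes> star A (t a j r)) UNIV
     = (\<Oplus>r\<in>UNIV. t a i r \<otimes> star A (t a j r))" for a i j
    by (rule eq) (intro cl tH)
  show "dephasing_relations (A\<lparr>carrier := H\<rparr>) t"
    using t tH unfolding dephasing_relations_def by (simp add: 1 eq[OF Q] eq[OF QQ])
qed

end

section \<open>Weights of a diagonalised state\<close>

text \<open>
  The density multiplies \<open>e a i j\<close> by its i-th eigenvalue, so by the trace formula the state vanishes on
  off-diagonal units. Positivity of the values on \<open>e a i i\<close> is faithfulness, as these are nonzero projections.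
\<close>

lemma diagonal_functional_of_state:
  assumes st: "state \<psi>" and f: "faithful \<psi>" and e: "matrix_units e" and d: "diagonalises e \<psi>"
  shows "diagonal_functional \<psi> e (\<lambda>a i. Re (\<psi> (e a i i)))"
proof -
  obtain \<rho> c where \<rho>: "is_density \<psi> \<rho>" "\<rho> = (\<Sum>a\<in>UNIV. \<Sum>i\<in>UNIV. bscale (c a i) (e a i i))"
    using d by (auto simp: diagonalises_def)
  have val: "\<psi> (e a i j) = (if i = j then c a i else 0)" for a i j
  proof -
    have m: "bmult (\<Sum>p\<in>I. g p) z = (\<Sum>p\<in>I. bmult (g p) z)" for g :: "'i \<Rightarrow> _" and I z
      by (induction I rule: infinite_finite_induct) (simp_all add: bmult_linear)
    have "bmult \<rho> (e a i j) = (\<Sum>b\<in>UNIV. \<Sum>k\<in>UNIV. if b = a \<and> k = i then bscale (c a i) (e a i j) else 0)"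
      unfolding \<rho>(2) m by (intro sum.cong refl) (auto simp: bmult_linear matrix_units_prod[OF e])
    also have "\<dots> = bscale (c a i) (e a i j)" by (simp add: sum_delta_conj)
    finally have \<rho>e: "bmult \<rho> (e a i j) = bscale (c a i) (e a i j)" .
    have "\<psi> (e a i j) = (\<Sum>b\<in>UNIV. trace (bmult \<rho> (e a i j) $ b))"
      using \<rho>(1) by (simp add: is_density_def bmult_def)
    also have "\<dots> = (\<Sum>b\<in>UNIV. c a i * trace (e a i j $ b))"
      unfolding \<rho>e by (simp add: trace_def bscale_def sum_distrib_left)
    also have "\<dots> = (\<Sum>b\<in>UNIV. if b = a then if i = j then c a i else 0 else 0)"
      by (rule sum.cong) (auto simp: trace_matrix_units[OF e])
    finally show ?thesis by simp
  qed
  have pos: "c a i = of_real (Re (c a i)) \<and> Re (c a i) > 0" for a i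
  proof -
    have sq: "bmult (bstar (e a i i)) (e a i i) = e a i i"
      using e by (simp add: matrix_units_def)
    have "c a i \<in> \<real>\<^sub>\<ge>\<^sub>0"
      using st val[of a i i] sq unfolding state_def by metis
    moreover have "e a i i \<noteq> 0"
      using trace_matrix_units[OF e, of a i i a] by (auto simp: trace_def)
    then have "c a i \<noteq> 0"
      using f val[of a i i] sq unfolding faithful_def by metis
    ultimately show ?thesis by (auto simp: nonneg_Reals_def)
  qed
  show ?thesis
  proof
    show "\<psi> (e a i j) = (if i = j then of_real (Re (\<psi> (e a i i))) else 0)" for a i j
      using pos[of a j] by (auto simp: val)
    show "Re (\<psi> (e a i i)) > 0" for a i using pos[of a i] by (simp add: val)
    show "matrix_units e" by (rule e)
  qed (use st in \<open>auto simp: state_def functional_iff\<close>)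
qed

lemma dephasing_of_graph:
  assumes "diagonal_functional \<psi> e (\<lambda>a i. Re (\<psi> (e a i i)))" and "\<delta> > 0"
    and D: "dephasing_graph \<delta> \<psi> e D"
  shows "dephasing \<psi> e (\<lambda>a i. Re (\<psi> (e a i i))) D \<delta>"
proof -
  define w where "w a i = Re (\<psi> (e a i i))" for a i
  interpret diagonal_functional \<psi> e w using assms(1) unfolding w_def .
  have val: "\<psi> (e a i i) = of_real (w a i)" for a i by (simp add: diagonal)
  have lin: "blinear D" using D by (simp add: dephasing_graph_def)
  have "D (e a i j) = (if i = j then bscale (of_real (w a i * \<delta>\<^sup>2)) (e a i i) else 0)" for a i j
  proof -
    \<comment> \<open>the scalar that turns \<open>e a i j\<close> into the adapted unit\<close>
    define \<kappa> where "\<kappa> = complex_of_real (w a i powr (-1/2) * w a j powr (-1/2))"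
    have \<kappa>: "\<kappa> \<noteq> 0" using weight_pos[of a i] weight_pos[of a j] by (simp add: \<kappa>_def)
    have unit: "adapted_unit \<psi> e a i j = bscale \<kappa> (e a i j)"
      unfolding adapted_unit_def \<kappa>_def w_def ..
    have "bscale \<kappa> (D (e a i j)) = D (adapted_unit \<psi> e a i j)"
      using lin by (simp add: blinear_iff unit)
    also have "\<dots> = bscale \<kappa> (if i = j then bscale (of_real (w a i * \<delta>\<^sup>2)) (e a i i) else 0)"
    proof (cases "i = j")
      case True
      have "D (adapted_unit \<psi> e a i j) = bscale (\<psi> (e a i i) * of_real (\<delta>\<^sup>2)) (adapted_unit \<psi> e a i j)"
        using D True unfolding dephasing_graph_def by metis
      also have "\<dots> = bscale \<kappa> (bscale (of_real (w a i * \<delta>\<^sup>2)) (e a i i))"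
        unfolding unit val blocks.scale_scale using True by (simp add: mult.commute)
      finally show ?thesis using True by simp
    next
      case False
      then show ?thesis using D unfolding dephasing_graph_def by simp
    qed
    finally show ?thesis using \<kappa> by (simp only: blocks.scale_cancel_left) simp
  qed
  then show ?thesis
    unfolding w_def[symmetric]
    using diagonal_functional_axioms lin \<open>\<delta> > 0\<close> by (simp add: dephasing_def dephasing_axioms_def)
qed

section \<open>The embedding of the Cuntz algebra\<close>

text \<open>
  The fixed points of \<open>g\<close> form a C*-subalgebra; it is closed because \<open>g\<close> is contractive.
\<close>

lemma star_hom_eq_id_on_generated:
  assumes K: "unital_cstar_algebra K" and g: "star_hom K K g"
    and gen: "carrier (cstar_generated K X) = carrier K"
    and X: "X \<subseteq> carrier K" and fix_X: "\<And>x. x \<in> X \<Longrightarrow> g x = x" and x: "x \<in> carrier K"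
  shows "g x = x"
proof -
  interpret K: unital_cstar_algebra K by fact
  have gc: "g x \<in> carrier K" if "x \<in> carrier K" for x
    using g that by (simp add: star_hom_def)
  have ga: "g (x \<oplus>\<^bsub>K\<^esub> y) = g x \<oplus>\<^bsub>K\<^esub> g y" "g (x \<otimes>\<^bsub>K\<^esub> y) = g x \<otimes>\<^bsub>K\<^esub> g y"
    if "x \<in> carrier K" "y \<in> carrier K" for x y
    using g that by (simp_all add: star_hom_def)
  have gs: "g (star K x) = star K (g x)" "g (scale K c x) = scale K c (g x)"
    if "x \<in> carrier K" for x c
    using g that by (simp_all add: star_hom_def)
  have g_diff: "g (x \<ominus>\<^bsub>K\<^esub> y) = g x \<ominus>\<^bsub>K\<^esub> g y" if "x \<in> carrier K" "y \<in> carrier K" for x y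
    using that by (simp add: K.diff_eq_scale K.scale_closed ga gs gc)
  have "cstar_subalgebra K {x \<in> carrier K. g x = x}"
    unfolding cstar_subalgebra_def
  proof (intro conjI ballI allI impI)
    show "\<zero>\<^bsub>K\<^esub> \<in> {x \<in> carrier K. g x = x}"
      using ga(1)[of "\<zero>\<^bsub>K\<^esub>" "\<zero>\<^bsub>K\<^esub>"] gc[of "\<zero>\<^bsub>K\<^esub>"] by simp
    show "x \<in> {x \<in> carrier K. g x = x}"
      if "(\<forall>k. Y k \<in> {x \<in> carrier K. g x = x}) \<and> x \<in> carrier K \<and> cstar_lim K Y x" for Y x
    proof -
      have Y: "Y k \<in> carrier K" "g (Y k) = Y k" for k using that by auto
      have x: "x \<in> carrier K" "cstar_lim K Y x" using that by auto
      have "cstar_lim K Y (g x)"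
      proof (rule K.lim_squeeze[OF Y(1) gc[OF x(1)] _ x(2)])
        show "cnorm K (Y k \<ominus>\<^bsub>K\<^esub> g x) \<le> cnorm K (Y k \<ominus>\<^bsub>K\<^esub> x)" for k
          using star_hom_contractive[OF K K g, of "Y k \<ominus>\<^bsub>K\<^esub> x"] Y[of k] x by (simp add: g_diff)
      qed
      then show ?thesis using K.lim_unique[OF Y(1) gc[OF x(1)] x(1) _ x(2)] x(1) by simp
    qed
  qed (simp_all add: ga gs K.star_closed K.scale_closed)
  then have "carrier (cstar_generated K X) \<subseteq> {x \<in> carrier K. g x = x}"
    by (rule K.generated_least) (use X fix_X in auto)
  then show ?thesis using gen x by auto
qed

theorem theorem4p3:
  fixes \<psi> :: "('d::finite, 'n::finite) blocks \<Rightarrow> complex"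
    and \<delta> :: real
    and e :: "'d \<Rightarrow> 'n \<Rightarrow> 'n \<Rightarrow> ('d, 'n) blocks"
    and D :: "('d, 'n) blocks \<Rightarrow> ('d, 'n) blocks"
    and C LO K :: "'u cstar"
    and s :: "('d, 'n) blocks \<Rightarrow> 'u"
    and t :: "'d \<Rightarrow> 'n \<Rightarrow> 'n \<Rightarrow> 'u"
    and V v :: "'n \<Rightarrow> 'u"
  assumes "state \<psi>" and "faithful \<psi>" and "delta_form \<delta> \<psi>"
    and "matrix_units e" and "diagonalises e \<psi>"
    and "dephasing_graph \<delta> \<psi> e D"
    and "universal_lqck_family \<delta> \<psi> D C s"
    and "LO = cstar_generated C (range s)"
    and "\<And>a i j. t a i j =
           scale LO (of_real (\<delta> * Re (\<psi> (e a i i)) powr (1/2))) (s (adapted_unit \<psi> e a i j))"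
    and "\<And>i. V i = (\<Oplus>\<^bsub>LO\<^esub>a\<in>UNIV. \<Oplus>\<^bsub>LO\<^esub>j\<in>UNIV. t a i j)"
    and "cuntz_algebra K v"
  shows "cuntz_isometries LO V \<and>
    (\<exists>\<pi>. unital_star_hom K LO \<pi> \<and> inj_on \<pi> (carrier K) \<and> (\<forall>i. \<pi> (v i) = V i))"
proof -
  define w where "w a i = Re (\<psi> (e a i i))" for a i
  have "\<delta> > 0" using assms(3) by (simp add: delta_form_def)
  interpret dephasing \<psi> e w D \<delta>
    unfolding w_def
    by (rule dephasing_of_graph[OF diagonal_functional_of_state \<open>\<delta> > 0\<close>]) (rule assms)+
  have C: "unital_cstar_algebra C" and s: "linear_into C s" and s_lqck: "lqck_family \<delta> \<psi> D C s"
    using assms(7) by (simp_all add: universal_lqck_family_def lqck_family_def)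
  interpret C: unital_cstar_algebra C by fact
  have sc: "s x \<in> carrier C" for x using s by (simp add: linear_into_def)
  define H where "H = carrier (cstar_generated C (range s))"
  have LO: "LO = C\<lparr>carrier := H\<rparr>" by (simp add: assms(8) H_def cstar_generated_def)
  have H: "cstar_subalgebra C H"
    unfolding H_def by (rule C.cstar_subalgebra_generated) (use sc in auto)
  have sH: "s x \<in> H" for x using C.generated_subset[of "range s"] by (auto simp: H_def)
  have t: "t a i j = scale C (of_real (\<delta> / sqrt (w a j))) (s (e a i j))" for a i j
  proof -
    have "s (adapted_unit \<psi> e a i j) = scale C (of_real (w a i powr (-1/2) * w a j powr (-1/2))) (s (e a i j))"
      using s by (simp add: linear_into_def adapted_unit_def w_def)
    moreover have "\<delta> * w a i powr (1/2) * (w a i powr (-1/2) * w a j powr (-1/2)) = \<delta> / sqrt (w a j)"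
      using weight_pos[of a i] weight_pos[of a j]
      by (simp add: powr_minus powr_half_sqrt field_simps)
    ultimately show ?thesis
      using sc by (simp add: assms(9) LO C.scale_scale flip: w_def of_real_mult)
  qed
  have tH: "t a i j \<in> H" for a i j
    using H sH by (simp add: t cstar_subalgebra_def)
  have t_C: "dephasing_relations C t"
    using lqck_family_iff[OF C s t] s_lqck by simp
  have one: "\<one>\<^bsub>C\<^esub> \<in> H" and t_LO: "dephasing_relations LO t"
    using C.dephasing_relations_subalgebra[OF t_C H tH] by (simp_all add: LO)
  have uLO: "unital_cstar_algebra LO"
    unfolding LO by (rule unital_cstar_subalgebra[OF C H one])
  interpret LO: unital_cstar_algebra LO by fact
  have V: "cuntz_isometries LO V"
    using LO.dephasing_relations_cuntz[OF t_LO] by (simp add: assms(10)[abs_def])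
  have K: "unital_cstar_algebra K" and v: "cuntz_isometries K v"
    and K_gen: "carrier (cstar_generated K (range v)) = carrier K"
    using assms(11) by (simp_all add: cuntz_algebra_def)
  interpret K: unital_cstar_algebra K by fact
  obtain \<pi> where \<pi>: "unital_star_hom K LO \<pi>" "\<And>i. \<pi> (v i) = V i"
    using assms(11) uLO V unfolding cuntz_algebra_def by blast
  \<comment> \<open>the block \<open>undefined\<close> is an arbitrary choice\<close>
  define t' where "t' = (\<lambda>(a :: 'd) i j. if a = undefined then v i \<otimes>\<^bsub>K\<^esub> (v j \<otimes>\<^bsub>K\<^esub> star K (v j)) else \<zero>\<^bsub>K\<^esub>)"
  have t'_rel: "dephasing_relations K t'" and t'_sum: "(\<Oplus>\<^bsub>K\<^esub>a\<in>UNIV. \<Oplus>\<^bsub>K\<^esub>j\<in>UNIV. t' a i j) = v i" for i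
    using K.cuntz_dephasing_relations[OF v t'_def] by simp_all
  have t'c: "t' a i j \<in> carrier K" for a i j using t'_rel by (simp add: dephasing_relations_def)
  obtain S where S: "linear_into K S"
      "\<And>a i j. S (e a i j) = scale K (of_real (sqrt (w a j) / \<delta>)) (t' a i j)"
    using linear_into_exists[OF K, of "\<lambda>a i j. scale K (of_real (sqrt (w a j) / \<delta>)) (t' a i j)"]
      t'c K.scale_closed by blast
  have S_t': "t' a i j = scale K (of_real (\<delta> / sqrt (w a j))) (S (e a i j))" for a i j
  proof -
    have "complex_of_real (\<delta> / sqrt (w a j)) * of_real (sqrt (w a j) / \<delta>) = 1"
      unfolding of_real_mult[symmetric] using weight_pos[of a j] \<open>\<delta> > 0\<close> by simp
    then show ?thesis by (simp only: S K.scale_scale[OF t'c] K.scale_one[OF t'c])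
  qed
  \<comment> \<open>universality of \<open>s\<close>, tested on the Cuntz algebra, yields the left inverse \<open>h\<close> of \<open>\<pi>\<close>\<close>
  have "lqck_family \<delta> \<psi> D K S"
    using lqck_family_iff[OF K S(1) S_t'] t'_rel by simp
  then obtain h where h0: "star_hom LO (cstar_generated K (range S)) h" and hS: "\<And>x. h (s x) = S x"
    using assms(7) unfolding universal_lqck_family_def assms(8) by blast
  have "range S \<subseteq> carrier K" using S(1) by (auto simp: linear_into_def)
  then have "carrier (cstar_generated K (range S)) \<subseteq> carrier K"
    using K.cstar_subalgebra_generated by (auto simp: cstar_subalgebra_def)
  then have h: "star_hom LO K h"
    using h0 by (auto simp: star_hom_def cstar_generated_def)
  have ht: "h (t a i j) = t' a i j" for a i j
    using h sH by (simp add: t star_hom_def LO hS S_t')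
  have tLO: "t a i j \<in> carrier LO" for a i j by (simp add: LO tH)
  have hV: "h (V i) = v i" for i
  proof -
    have "h (V i) = (\<Oplus>\<^bsub>K\<^esub>a\<in>UNIV. h (\<Oplus>\<^bsub>LO\<^esub>j\<in>UNIV. t a i j))"
      unfolding assms(10) by (rule star_hom_finsum[OF uLO K h]) (auto intro!: LO.finsum_closed tLO)
    also have "\<dots> = (\<Oplus>\<^bsub>K\<^esub>a\<in>UNIV. \<Oplus>\<^bsub>K\<^esub>j\<in>UNIV. t' a i j)"
      by (simp add: star_hom_finsum[OF uLO K h] tLO ht)
    finally show ?thesis by (simp add: t'_sum)
  qed
  have h\<pi>: "star_hom K K (\<lambda>x. h (\<pi> x))"
    using h \<pi>(1) by (simp add: star_hom_def unital_star_hom_def)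
  have "h (\<pi> x) = x" if "x \<in> carrier K" for x
    by (rule star_hom_eq_id_on_generated[OF K h\<pi> K_gen _ _ that])
       (use v \<pi>(2) hV in \<open>auto simp: cuntz_isometries_def\<close>)
  then have "inj_on \<pi> (carrier K)" by (rule inj_on_inverseI)
  with V \<pi> show ?thesis by blast
qed

end
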